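(* Let $k\geqslant 2$ be an integer. Let $F(z)\in\mathbb{C}[[z]]$ be a $k$-Mahler function of degree $d_F$ and height $A_F$ which is irrational (i.e. not the power series expansion of a rational function in $\mathbb{C}(z)$), and let $G(z)\in\mathbb{C}[[z]]$ be an algebraic function of degree at most $n$ and height at most $H_G$. Then $$\nu\big(F(z)-G(z)\big)\leqslant (d_F+1)\cdot A_F\cdot n^{d_F+1}+\frac{k^{d_F+1}-1}{k-1}\cdot\log H_G\cdot n^{d_F}.$$
   Context: Mahler functions: for an integer $k\geqslant 2$, a power series $f(z)\in\mathbb{C}[[z]]$ is a $k$-Mahler function if there are an integer $d\geqslant 1$ and polynomials $a_0(z),\ldots,a_d(z)\in\mathbb{C}[z]$, not all zero, such that $$a_0(z)f(z)+a_1(z)f(z^k)+\cdots+a_d(z)f(z^{k^d})=0.$$ The minimal $d\geqslant 1$ for which such an equation holds is the degree of $f$, denoted $d_f$. The height of $f$ is $A_f:=\max\{\deg a_i(z): i=0,\ldots,d_f\}$, where $a_0,\ldots,a_{d_f}$ are the coefficients of a fixed such equation with $d=d_f$. Algebraic functions: $G(z)$ is an algebraic function if it is algebraic over $\mathbb{C}(z)$. Let $P(z,y)\in\mathbb{C}[z,y]$ be its minimal polynomial, i.e. the polynomial, irreducible in $\mathbb{C}[z,y]$ and unique up to a nonzero constant, with $P(z,G(z))=0$. The degree of $G$ is $\deg_y P(z,y)$ and the height of $G$ is $\exp(\deg_z P(z,y))$. Valuation: $\nu:\mathbb{C}((z))\to\mathbb{Z}\cup\{\infty\}$ is given by $\nu(0)=\infty$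 and $\nu\left(\sum c_nz^n\right)=\min\{i:c_i\neq 0\}$ for a nonzero series. *)

theory Defs
  imports
    "HOL-Computational_Algebra.Computational_Algebra"
    "HOL-Library.Extended_Real"
begin

definition fls_of_poly :: "complex poly \<Rightarrow> complex fls" where
  "fls_of_poly p = fps_to_fls (fps_of_poly p)"

(* The field C(z), viewed inside C((z)) through expansion at 0. *)
definition rational_functions :: "complex fls set" where
  "rational_functions = {fls_of_poly p / fls_of_poly q |p q. q \<noteq> 0}"

definition mahler_equation ::
  "nat \<Rightarrow> nat \<Rightarrow> (nat \<Rightarrow> complex poly) \<Rightarrow> complex fps \<Rightarrow> bool" where
  "mahler_equation k d a f \<longleftrightarrow>
     d \<ge> 1 \<and> (\<exists>i\<le>d. a i \<noteq> 0) \<and>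
     (\<Sum>i\<le>d. fps_of_poly (a i) * fps_compose f (fps_X ^ (k ^ i))) = 0"

definition mahler_function :: "nat \<Rightarrow> complex fps \<Rightarrow> bool" where
  "mahler_function k f \<longleftrightarrow> (\<exists>d a. mahler_equation k d a f)"

definition mahler_degree :: "nat \<Rightarrow> complex fps \<Rightarrow> nat" where
  "mahler_degree k f = (LEAST d. \<exists>a. mahler_equation k d a f)"

(* The height depends on the chosen equation of minimal degree, hence on the coefficients a.
   The convention degree 0 = 0 is harmless, since the a i with i \<le> d are not all zero. *)
definition mahler_height :: "nat \<Rightarrow> (nat \<Rightarrow> complex poly) \<Rightarrow> nat" where
  "mahler_height d a = Max ((\<lambda>i. degree (a i)) ` {..d})"

definition algebraic_function :: "complex fps \<Rightarrow> bool" where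
  "algebraic_function g \<longleftrightarrow>
     (\<exists>p :: complex fls poly.
        p \<noteq> 0 \<and> (\<forall>i. coeff p i \<in> rational_functions) \<and> poly p (fps_to_fls g) = 0)"

(* C[z,y] is represented as C[z][y]: the outer variable is y, the coefficients are in C[z]. *)
definition is_minimal_poly :: "complex fps \<Rightarrow> complex poly poly \<Rightarrow> bool" where
  "is_minimal_poly g P \<longleftrightarrow> irreducible P \<and> poly (map_poly fps_of_poly P) g = 0"

(* For algebraic g this is determined up to a nonzero constant, which affects neither
   of the two degrees below. *)
definition minimal_poly :: "complex fps \<Rightarrow> complex poly poly" where
  "minimal_poly g = (SOME P. is_minimal_poly g P)"

definition deg_z :: "complex poly poly \<Rightarrow> nat" where
  "deg_z P = Max ((\<lambda>i. degree (coeff P i)) ` {..degree P})"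

definition algebraic_degree :: "complex fps \<Rightarrow> nat" where
  "algebraic_degree g = degree (minimal_poly g)"

definition algebraic_height :: "complex fps \<Rightarrow> real" where
  "algebraic_height g = exp (real (deg_z (minimal_poly g)))"

definition valuation :: "complex fls \<Rightarrow> ereal" where
  "valuation f = (if f = 0 then \<infinity> else ereal (real_of_int (fls_subdegree f)))"

end

theory Submission
  imports Defs "Jordan_Normal_Form.Determinant" "HOL-Computational_Algebra.Field_as_Ring"
begin

text \<open>
  Put \<open>T x = (\<Sum>i\<le>d. a\<^sub>i x(z ^ (k ^ i)))\<close>, so that \<open>T F = 0\<close> and \<open>T (F - G) = - T G\<close> vanishes at 0 to
  order at least \<open>\<nu> (F - G)\<close>. If \<open>T G \<noteq> 0\<close>, iterated resultants give an annihilating polynomial of the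
  algebraic function \<open>T G\<close> of bounded degree in \<open>z\<close>, and its lowest nonzero coefficient is divisible
  by \<open>T G\<close>. If \<open>T G = 0\<close>, then \<open>F - G\<close> solves the Mahler equation itself, and comparing the orders of the
  terms suffices, provided that \<open>F \<noteq> G\<close>.

  That \<open>F \<noteq> G\<close> means that an algebraic Mahler function is rational. Solving the equation for
  its lowest term over and over, one finds that the series \<open>F(\<omega> z)\<close>, for \<open>\<omega>\<close> any root of unity of order
  \<open>k ^ s\<close>, all lie in the finite-dimensional space spanned by the \<open>F(z ^ (k ^ i))\<close> over \<open>\<complex>(z)\<close>. Let \<open>f\<close> be
  \<open>F\<close> times the leading coefficient of its minimal polynomial. Averaging over \<open>\<omega>\<close>, the part of \<open>f\<close> with
  exponents congruent to \<open>r\<close> modulo \<open>k ^ s\<close> is then of bounded degree over \<open>\<complex>(z)\<close>, integral over \<open>\<complex>[z]\<close>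
  and of bounded growth at infinity, so its order at 0 is bounded independently of \<open>r\<close> and \<open>s\<close>
  unless it vanishes. Since for \<open>r < k ^ s\<close> this order is at least \<open>r\<close>, the series \<open>f\<close> is a polynomial.
\<close>

subsection \<open>Determinants of polynomial matrices\<close>

text \<open>The weights \<open>w i\<close> are only upper bounds, so the coefficient at
  \<open>sum w S\<close> may be zero; in this form it applies to the products in a Leibniz
  expansion.\<close>

lemma prod_degree_coeff:
  fixes f :: "'i \<Rightarrow> 'a::comm_ring_1 poly" and w :: "'i \<Rightarrow> nat"
  assumes "finite S" and "\<And>i. i \<in> S \<Longrightarrow> degree (f i) \<le> w i"
  shows "degree (prod f S) \<le> sum w S \<and> coeff (prod f S) (sum w S) = (\<Prod>i\<in>S. coeff (f i) (w i))"
  using assms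
proof (induction S rule: finite_induct)
  case (insert x S)
  let ?p = "prod f S" and ?d = "sum w S"
  have IH: "degree ?p \<le> ?d" "coeff ?p ?d = (\<Prod>i\<in>S. coeff (f i) (w i))" and fx: "degree (f x) \<le> w x"
    using insert by auto
  have "degree (f x * ?p) \<le> w x + ?d"
    using degree_mult_le[of "f x" ?p] IH(1) fx by linarith
  moreover have "coeff (f x * ?p) (w x + ?d) = coeff (f x) (w x) * coeff ?p ?d"
  proof -
    have "coeff (f x * ?p) (w x + ?d) = (\<Sum>i\<le>w x + ?d. coeff (f x) i * coeff ?p (w x + ?d - i))"
      by (rule coeff_mult)
    also have "\<dots> = (\<Sum>i\<in>{w x}. coeff (f x) i * coeff ?p (w x + ?d - i))"
    proof (rule sum.mono_neutral_right)
      show "\<forall>i\<in>{..w x + ?d} - {w x}. coeff (f x) i * coeff ?p (w x + ?d - i) = 0"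
      proof
        fix i assume i: "i \<in> {..w x + ?d} - {w x}"
        show "coeff (f x) i * coeff ?p (w x + ?d - i) = 0"
        proof (cases "i > w x")
          case True
          then show ?thesis using fx by (simp add: coeff_eq_0)
        next
          case False
          then have "w x + ?d - i > ?d" using i by auto
          then show ?thesis using IH(1) by (simp add: coeff_eq_0)
        qed
      qed
    qed auto
    finally show ?thesis by simp
  qed
  ultimately show ?case using insert IH by simp
qed simp

text \<open>For a permutation p the sum of the \<open>u r + \<kappa> * int (p r)\<close> does not
  depend on p, so all Leibniz terms obey the same bound W, and their coefficients at W form the
  Leibniz expansion of a determinant of scalars. Zero entries are exempt, since the bound may be
  negative at their places.\<close>

lemma degree_coeff_det_graded:
  fixes B :: "'a::comm_ring_1 poly mat" and u :: "nat \<Rightarrow> int" and \<kappa> :: int and W :: nat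
  assumes B: "B \<in> carrier_mat N N"
    and deg: "\<And>r l. r < N \<Longrightarrow> l < N \<Longrightarrow> B $$ (r, l) \<noteq> 0 \<Longrightarrow>
      int (degree (B $$ (r, l))) \<le> u r + \<kappa> * int l"
    and W: "int W = (\<Sum>r<N. u r + \<kappa> * int r)"
  shows "degree (det B) \<le> W"
    and "coeff (det B) W = det (mat N N (\<lambda>(r, l). coeff (B $$ (r, l)) (nat (u r + \<kappa> * int l))))"
proof -
  let ?C = "mat N N (\<lambda>(r, l). coeff (B $$ (r, l)) (nat (u r + \<kappa> * int l)))"
  have perm: "degree (\<Prod>i = 0..<N. B $$ (i, p i)) \<le> W \<and>
      coeff (\<Prod>i = 0..<N. B $$ (i, p i)) W = (\<Prod>i = 0..<N. ?C $$ (i, p i))"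
    if p: "p permutes {0..<N}" for p
  proof -
    have pN: "p i < N" if "i < N" for i using permutes_in_image[OF p, of i] that by simp
    show ?thesis
    proof (cases "\<exists>i<N. B $$ (i, p i) = 0")
      case True
      then obtain i where i: "i < N" "B $$ (i, p i) = 0" by auto
      then have "(\<Prod>i = 0..<N. B $$ (i, p i)) = 0" "(\<Prod>i = 0..<N. ?C $$ (i, p i)) = 0"
        using pN by (auto intro!: prod_zero bexI[of _ i])
      then show ?thesis by simp
    next
      case False
      \<comment> \<open>The entries \<open>B $$ (i, p i)\<close> are nonzero here, so their bounds
        are nonnegative and \<open>nat\<close> loses nothing.\<close>
      define w where "w i = nat (u i + \<kappa> * int (p i))" for i
      have d: "int (degree (B $$ (i, p i))) \<le> u i + \<kappa> * int (p i)" if "i < N" for i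
        using deg[OF that pN[OF that]] False that by auto
      have "int (\<Sum>i<N. w i) = (\<Sum>i<N. u i + \<kappa> * int (p i))"
        unfolding of_nat_sum w_def by (rule sum.cong) (use d in \<open>auto dest!: d\<close>)
      also have "\<dots> = (\<Sum>i<N. u i) + \<kappa> * (\<Sum>i<N. int (p i))"
        by (simp add: sum.distrib sum_distrib_left)
      also have "(\<Sum>i<N. int (p i)) = (\<Sum>i<N. int i)"
        using sum.permute[OF p, of int] by (simp add: o_def atLeast0LessThan)
      also have "(\<Sum>i<N. u i) + \<kappa> * (\<Sum>i<N. int i) = int W"
        using W by (simp add: sum.distrib sum_distrib_left)
      finally have sw: "sum w {0..<N} = W" by (simp only: of_nat_eq_iff atLeast0LessThan)
      have "degree (B $$ (i, p i)) \<le> w i" if "i \<in> {0..<N}" for i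
        using d[of i] that by (simp add: w_def)
      from prod_degree_coeff[OF _ this, of "{0..<N}"] sw
      have "degree (\<Prod>i = 0..<N. B $$ (i, p i)) \<le> W"
        "coeff (\<Prod>i = 0..<N. B $$ (i, p i)) W = (\<Prod>i = 0..<N. coeff (B $$ (i, p i)) (w i))"
        by auto
      moreover have "(\<Prod>i = 0..<N. coeff (B $$ (i, p i)) (w i)) = (\<Prod>i = 0..<N. ?C $$ (i, p i))"
        by (rule prod.cong) (auto simp: w_def pN)
      ultimately show ?thesis by simp
    qed
  qed
  have sgn: "signof p * (x::'a poly) = (if sign p = 1 then x else - x)"
    "signof p * (y::'a) = (if sign p = 1 then y else - y)" for p :: "nat \<Rightarrow> nat" and x y
    by (auto simp: sign_def)
  show "degree (det B) \<le> W"
    unfolding det_def'[OF B] by (rule degree_sum_le) (auto simp: finite_permutations sgn perm)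
  have C: "?C \<in> carrier_mat N N" by simp
  show "coeff (det B) W = det ?C"
    unfolding det_def'[OF B] det_def'[OF C] coeff_sum
    by (rule sum.cong) (auto simp: sgn perm)
qed

subsection \<open>The polynomial of a sum\<close>

definition hom_eval :: "('a::comm_ring_1 \<Rightarrow> 'b::comm_ring_1) \<Rightarrow> 'b \<Rightarrow> 'a poly \<Rightarrow> 'b" where
  "hom_eval h x p = poly (map_poly h p) x"

context comm_ring_hom begin

lemma map_poly_coeff: "coeff (map_poly hom p) i = hom (coeff p i)"
  by (simp add: coeff_map_poly)

lemma hom_eval_altdef:
  assumes "degree p \<le> n"
  shows "hom_eval hom x p = (\<Sum>i\<le>n. hom (coeff p i) * x ^ i)"
proof -
  have "hom_eval hom x p = (\<Sum>i\<le>degree (map_poly hom p). hom (coeff p i) * x ^ i)"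
    by (simp add: hom_eval_def poly_altdef map_poly_coeff)
  also have "\<dots> = (\<Sum>i\<le>n. hom (coeff p i) * x ^ i)"
  proof (rule sum.mono_neutral_left)
    have "degree (map_poly hom p) \<le> degree p"
      by (rule degree_le) (simp add: map_poly_coeff coeff_eq_0)
    then show "{..degree (map_poly hom p)} \<subseteq> {..n}" using assms by auto
    show "\<forall>i\<in>{..n} - {..degree (map_poly hom p)}. hom (coeff p i) * x ^ i = 0"
      by (auto simp flip: map_poly_coeff simp: coeff_eq_0)
  qed simp
  finally show ?thesis .
qed

lemma comm_ring_hom_hom_eval: "comm_ring_hom (hom_eval hom x)"
proof
  have "map_poly hom 1 = 1" by (rule poly_eqI) (simp add: map_poly_coeff coeff_1 hom_one hom_zero)
  then show "hom_eval hom x 1 = 1" by (simp add: hom_eval_def)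
  show "hom_eval hom x 0 = 0" by (simp add: hom_eval_def)
  fix p q
  have "map_poly hom (p + q) = map_poly hom p + map_poly hom q"
    by (rule poly_eqI) (simp add: map_poly_coeff hom_add)
  then show "hom_eval hom x (p + q) = hom_eval hom x p + hom_eval hom x q"
    by (simp add: hom_eval_def)
  have "map_poly hom (p * q) = map_poly hom p * map_poly hom q"
    by (rule poly_eqI) (simp add: map_poly_coeff coeff_mult hom_sum hom_mult)
  then show "hom_eval hom x (p * q) = hom_eval hom x p * hom_eval hom x q"
    by (simp add: hom_eval_def)
qed

lemma hom_eval_const [simp]: "hom_eval hom x [:a:] = hom a"
  by (simp add: hom_eval_def map_poly_pCons)

end

text \<open>The coefficient of \<open>y ^ m\<close> in \<open>Q (t - a y)\<close>, as a polynomial in \<open>t\<close>.\<close>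
definition shear_coeff :: "'a::comm_ring_1 poly \<Rightarrow> 'a \<Rightarrow> nat \<Rightarrow> 'a poly" where
  "shear_coeff Q a m =
     (\<Sum>e\<le>degree Q - m. monom (of_nat ((m + e) choose m) * (- a) ^ m * coeff Q (m + e)) e)"

lemma coeff_shear_coeff:
  "coeff (shear_coeff Q a m) e = of_nat ((m + e) choose m) * (- a) ^ m * coeff Q (m + e)"
proof -
  have "coeff (shear_coeff Q a m) e =
      (if e \<le> degree Q - m then of_nat ((m + e) choose m) * (- a) ^ m * coeff Q (m + e) else 0)"
    unfolding shear_coeff_def coeff_sum coeff_monom by (simp add: sum.delta)
  also have "\<dots> = of_nat ((m + e) choose m) * (- a) ^ m * coeff Q (m + e)"
    by (auto simp: coeff_eq_0)
  finally show ?thesis .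
qed

lemma shear_coeff_eq_0: "m > degree Q \<Longrightarrow> shear_coeff Q a m = 0"
  by (rule poly_eqI) (simp add: coeff_shear_coeff coeff_eq_0)

lemma degree_shear_coeff: "degree (shear_coeff Q a m) \<le> degree Q - m"
  by (rule degree_le) (auto simp: coeff_shear_coeff coeff_eq_0)

text \<open>The binomial theorem for each \<open>(t - hom a * y) ^ i\<close>, with i = m + e and the
  resulting triangle of pairs summed by the power m of y.\<close>

lemma (in comm_ring_hom) sum_hom_eval_shear_coeff:
  assumes "degree Q \<le> D"
  shows "(\<Sum>m\<le>D. hom_eval hom t (shear_coeff Q a m) * y ^ m) = hom_eval hom (t - hom a * y) Q"
proof -
  let ?q = "\<lambda>i. hom (coeff Q i)"
  let ?g = "\<lambda>m e. of_nat ((m + e) choose m) * (- (hom a * y)) ^ m * t ^ e * ?q (m + e)"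
  have "hom_eval hom t (shear_coeff Q a m) * y ^ m = (\<Sum>e\<le>D - m. ?g m e)" for m
  proof -
    have "degree (shear_coeff Q a m) \<le> D - m"
      using degree_shear_coeff[of Q a m] assms by linarith
    moreover have pow: "(- (hom a * y)) ^ m = (- hom a) ^ m * y ^ m"
      by (simp flip: power_mult_distrib)
    ultimately show ?thesis
      by (simp add: hom_eval_altdef[where n = "D - m"] coeff_shear_coeff hom_distribs sum_distrib_right
          pow mult_ac)
  qed
  then have "(\<Sum>m\<le>D. hom_eval hom t (shear_coeff Q a m) * y ^ m) = (\<Sum>m\<le>D. \<Sum>e\<le>D - m. ?g m e)"
    by simp
  also have "\<dots> = (\<Sum>(m, e)\<in>{(m, e). m + e \<le> D}. ?g m e)"
  proof -
    have "{(m, e). m + e \<le> D} = Sigma {..D} (\<lambda>m. {..D - m})" by auto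
    then show ?thesis by (simp add: sum.Sigma)
  qed
  also have "\<dots> = (\<Sum>i\<le>D. \<Sum>m\<le>i. ?g m (i - m))"
    by (subst sum.triangle_reindex_eq) simp
  also have "\<dots> = (\<Sum>i\<le>D. ?q i * (t - hom a * y) ^ i)"
  proof (rule sum.cong)
    fix i assume "i \<in> {..D}"
    have "(t - hom a * y) ^ i = (- (hom a * y) + t) ^ i" by simp
    also have "\<dots> = (\<Sum>m\<le>i. of_nat (i choose m) * (- (hom a * y)) ^ m * t ^ (i - m))"
      by (rule binomial_ring)
    finally show "(\<Sum>m\<le>i. ?g m (i - m)) = ?q i * (t - hom a * y) ^ i"
      by (simp add: sum_distrib_left mult_ac)
  qed simp
  also have "\<dots> = hom_eval hom (t - hom a * y) Q"
    using hom_eval_altdef[OF assms] by simp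
  finally show ?thesis .
qed

text \<open>The Sylvester matrix, with respect to \<open>y\<close>, of \<open>Q (t - a y)\<close> and \<open>P (y)\<close>; columns are indexed by
  increasing powers of \<open>y\<close>.\<close>
definition sum_mat :: "'a::comm_ring_1 poly \<Rightarrow> 'a poly \<Rightarrow> 'a \<Rightarrow> 'a poly mat" where
  "sum_mat P Q a = (let n = degree P; N = n + degree Q in mat N N (\<lambda>(r, l).
     if r < n then (if r \<le> l then shear_coeff Q a (l - r) else 0)
     else (if r - n \<le> l then [:coeff P (l - (r - n)):] else 0)))"

text \<open>Up to sign, the resultant in y of Q (t - a y) and P (y) for the formal degrees
  \<open>degree Q\<close> and \<open>degree P\<close>. For nonzero P and Q over a domain its roots
  in t, in an algebraic closure, are the sums x + a y of roots x of Q and y of P.\<close>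

definition sum_poly :: "'a::comm_ring_1 poly \<Rightarrow> 'a poly \<Rightarrow> 'a \<Rightarrow> 'a poly" where
  "sum_poly P Q a = det (sum_mat P Q a)"

lemma sum_mat_carrier:
  "sum_mat P Q a \<in> carrier_mat (degree P + degree Q) (degree P + degree Q)"
  by (simp add: sum_mat_def Let_def)

lemma sum_mat_index:
  assumes "r < degree P + degree Q" "l < degree P + degree Q"
  shows "sum_mat P Q a $$ (r, l) =
    (if r < degree P then (if r \<le> l then shear_coeff Q a (l - r) else 0)
     else (if r - degree P \<le> l then [:coeff P (l - (r - degree P)):] else 0))"
  using assms by (simp add: sum_mat_def Let_def)

text \<open>Giving t and y weight 1 bounds the entries as in \<open>degree_coeff_det_graded\<close>
  with slope -1. The matrix of extremal coefficients is upper triangular: a row of Q begins on the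
  diagonal with \<open>lead_coeff Q\<close>, and of a row of P only the diagonal entry
  \<open>lead_coeff P\<close> remains.\<close>

lemma degree_coeff_sum_poly:
  fixes P Q :: "'a::idom poly"
  shows "degree (sum_poly P Q a) \<le> degree P * degree Q"
    and "coeff (sum_poly P Q a) (degree P * degree Q) =
      lead_coeff Q ^ degree P * lead_coeff P ^ degree Q"
proof -
  let ?n = "degree P" and ?D = "degree Q"
  let ?N = "?n + ?D" and ?M = "sum_mat P Q a"
  define u where "u r = (if r < ?n then int r + int ?D else int r)" for r
  have deg: "int (degree (?M $$ (r, l))) \<le> u r + (-1) * int l"
    if "r < ?N" "l < ?N" "?M $$ (r, l) \<noteq> 0" for r l
  proof (cases "r < ?n")
    case True
    with that have rl: "r \<le> l" and nz: "shear_coeff Q a (l - r) \<noteq> 0"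
      by (auto simp: sum_mat_index split: if_splits)
    from nz have "l - r \<le> ?D" using shear_coeff_eq_0[of Q "l - r" a] by fastforce
    then show ?thesis
      using degree_shear_coeff[of Q a "l - r"] that rl True by (simp add: sum_mat_index u_def)
  next
    case False
    with that have rl: "r - ?n \<le> l" and nz: "coeff P (l - (r - ?n)) \<noteq> 0"
      by (auto simp: sum_mat_index split: if_splits)
    from nz have "l - (r - ?n) \<le> ?n" by (rule le_degree)
    then show ?thesis using that rl False by (simp add: sum_mat_index u_def)
  qed
  have "(\<Sum>r<?N. u r + (-1) * int r) = (\<Sum>r<?N. if r < ?n then int ?D else 0)"
    by (rule sum.cong) (auto simp: u_def)
  also have "\<dots> = (\<Sum>r<?n. int ?D)"
    by (rule sum.mono_neutral_cong_right) auto
  finally have W: "int (?n * ?D) = (\<Sum>r<?N. u r + (-1) * int r)" by simp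
  note graded = degree_coeff_det_graded[OF sum_mat_carrier deg W, folded sum_poly_def]
  show "degree (sum_poly P Q a) \<le> ?n * ?D" by (rule graded(1))
  let ?C = "mat ?N ?N (\<lambda>(r, l). coeff (?M $$ (r, l)) (nat (u r + (-1) * int l)))"
  have C: "?C $$ (r, l) = (if r < ?n then (if r \<le> l \<and> l - r \<le> ?D
        then of_nat (?D choose (l - r)) * (- a) ^ (l - r) * lead_coeff Q else 0)
      else (if l = r then lead_coeff P else 0))"
    if "r < ?N" "l < ?N" for r l
  proof (cases "r < ?n")
    case True
    then show ?thesis
    proof (cases "r \<le> l \<and> l - r \<le> ?D")
      case le: True
      then have e: "nat (u r + (-1) * int l) = ?D - (l - r)" "l - r + (?D - (l - r)) = ?D"
        using True le by (auto simp: u_def)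
      have "?C $$ (r, l) = coeff (shear_coeff Q a (l - r)) (?D - (l - r))"
        using that True le by (simp add: sum_mat_index e(1)[simplified])
      then show ?thesis using True le by (simp only: coeff_shear_coeff e(2) if_True simp_thms)
    next
      case False
      then show ?thesis using True that
        by (auto simp: sum_mat_index shear_coeff_eq_0)
    qed
  next
    case False
    show ?thesis
    proof (cases "r < l")
      case True
      then have "l - (r - ?n) > ?n" using False by linarith
      then show ?thesis using that False True by (simp add: sum_mat_index coeff_eq_0)
    next
      case le: False
      then have e: "nat (u r + (-1) * int l) = r - l" using False by (simp add: u_def)
      show ?thesis
        using that False le by (auto simp: sum_mat_index e[simplified] coeff_pCons split: nat.splits)
    qed
  qed
  have ut: "upper_triangular ?C"
    by (rule upper_triangularI) (subst C, auto)
  have "det ?C = (\<Prod>r = 0..<?N. ?C $$ (r, r))"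
    using det_upper_triangular[OF ut, of ?N] by (simp add: prod_list_diag_prod)
  also have "\<dots> = (\<Prod>r = 0..<?N. if r < ?n then lead_coeff Q else lead_coeff P)"
    by (rule prod.cong[OF refl], subst C) auto
  also have "\<dots> = (\<Prod>r = 0..<?n. lead_coeff Q) * (\<Prod>r = ?n..<?N. lead_coeff P)"
    by (subst prod.atLeastLessThan_concat[of 0 ?n ?N, symmetric]) auto
  finally show "coeff (sum_poly P Q a) (?n * ?D) = lead_coeff Q ^ ?n * lead_coeff P ^ ?D"
    using graded(2) by simp
qed

lemma degree_sum_poly:
  fixes P Q :: "'a::idom poly"
  assumes "P \<noteq> 0" "Q \<noteq> 0"
  shows "degree (sum_poly P Q a) = degree P * degree Q"
    and "lead_coeff (sum_poly P Q a) = lead_coeff Q ^ degree P * lead_coeff P ^ degree Q"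
    and "sum_poly P Q a \<noteq> 0"
proof -
  have "coeff (sum_poly P Q a) (degree P * degree Q) \<noteq> 0"
    using assms by (simp add: degree_coeff_sum_poly(2))
  then show d: "degree (sum_poly P Q a) = degree P * degree Q" and "sum_poly P Q a \<noteq> 0"
    using degree_coeff_sum_poly(1)[of P Q a] le_degree by (force intro: antisym)+
  show "lead_coeff (sum_poly P Q a) = lead_coeff Q ^ degree P * lead_coeff P ^ degree Q"
    by (simp only: d degree_coeff_sum_poly(2))
qed

text \<open>The vector of powers of \<open>y\<close> lies in the kernel of the specialized Sylvester matrix.\<close>
lemma hom_eval_sum_poly:
  fixes hom :: "'a::idom \<Rightarrow> 'b::idom"
  assumes "comm_ring_hom hom"
    and "degree P > 0"
    and P: "hom_eval hom y P = 0" and Q: "hom_eval hom x Q = 0"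
  shows "hom_eval hom (x + hom a * y) (sum_poly P Q a) = 0"
proof -
  interpret h: comm_ring_hom hom by fact
  let ?n = "degree P" and ?D = "degree Q"
  let ?N = "?n + ?D" and ?M = "sum_mat P Q a"
  define t where "t = x + hom a * y"
  interpret e: comm_ring_hom "hom_eval hom t" by (rule h.comm_ring_hom_hom_eval)
  let ?E = "map_mat (hom_eval hom t) ?M"
  define v where "v = vec ?N (\<lambda>l. y ^ l)"
  have E: "?E \<in> carrier_mat ?N ?N" using sum_mat_carrier[of P Q a] by simp
  have v: "v \<in> carrier_vec ?N" by (simp add: v_def)
  \<comment> \<open>The entry \<open>y ^ 0\<close> makes \<open>v\<close> nonzero even for y = 0;
    \<open>degree P > 0\<close> makes the matrix nonempty.\<close>
  have "v $ 0 = 1" "0 < ?N" using assms by (auto simp: v_def)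
  then have "v \<noteq> 0\<^sub>v ?N" by (metis index_zero_vec(1) zero_neq_one)
  moreover have "?E *\<^sub>v v = 0\<^sub>v ?N"
  proof (rule eq_vecI)
    fix r assume "r < dim_vec (0\<^sub>v ?N :: 'b vec)"
    then have r: "r < ?N" by simp
    have M: "dim_row ?M = ?N" "dim_col ?M = ?N" using sum_mat_carrier[of P Q a] by auto
    have "(?E *\<^sub>v v) $ r = (\<Sum>l<?N. hom_eval hom t (?M $$ (r, l)) * y ^ l)"
      using r M by (simp add: scalar_prod_def v_def atLeast0LessThan)
    also have "\<dots> = 0"
    proof (cases "r < ?n")
      case True
      have "(\<Sum>l<?N. hom_eval hom t (?M $$ (r, l)) * y ^ l) =
          (\<Sum>l\<in>{r..r + ?D}. hom_eval hom t (shear_coeff Q a (l - r)) * y ^ l)"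
        using True by (intro sum.mono_neutral_cong_right)
          (auto simp: sum_mat_index shear_coeff_eq_0)
      also have "\<dots> = (\<Sum>m\<le>?D. hom_eval hom t (shear_coeff Q a m) * y ^ (m + r))"
        by (rule sum.reindex_bij_witness[of _ "\<lambda>m. m + r" "\<lambda>l. l - r"]) auto
      also have "\<dots> = y ^ r * (\<Sum>m\<le>?D. hom_eval hom t (shear_coeff Q a m) * y ^ m)"
        by (simp add: sum_distrib_left power_add mult_ac)
      also have "\<dots> = y ^ r * hom_eval hom x Q"
        by (subst h.sum_hom_eval_shear_coeff) (auto simp: t_def)
      finally show ?thesis using Q by simp
    next
      case False
      let ?i = "r - ?n"
      have "(\<Sum>l<?N. hom_eval hom t (?M $$ (r, l)) * y ^ l) =
          (\<Sum>l\<in>{?i..?i + ?n}. hom (coeff P (l - ?i)) * y ^ l)"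
        using False r by (intro sum.mono_neutral_cong_right)
          (auto simp: sum_mat_index coeff_eq_0)
      also have "\<dots> = (\<Sum>m\<le>?n. hom (coeff P m) * y ^ (m + ?i))"
        by (rule sum.reindex_bij_witness[of _ "\<lambda>m. m + ?i" "\<lambda>l. l - ?i"]) auto
      also have "\<dots> = y ^ ?i * (\<Sum>m\<le>?n. hom (coeff P m) * y ^ m)"
        by (simp add: sum_distrib_left power_add mult_ac)
      also have "(\<Sum>m\<le>?n. hom (coeff P m) * y ^ m) = hom_eval hom y P"
        using h.hom_eval_altdef[of P ?n y] by simp
      finally show ?thesis using P by simp
    qed
    finally show "(?E *\<^sub>v v) $ r = 0\<^sub>v ?N $ r" using r by simp
  qed (use E in auto)
  ultimately have "det ?E = 0" using det_0_iff_vec_prod_zero[OF E] v by blast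
  then show ?thesis using e.hom_det[of ?M] by (simp add: sum_poly_def t_def)
qed

subsection \<open>Weights\<close>

text \<open>The substitution \<open>z \<mapsto> s\<close>, \<open>t \<mapsto> u s ^ c\<close>; it turns the weight giving \<open>z\<close> weight 1 and \<open>t\<close>
  weight \<open>c\<close> into the degree in \<open>s\<close>.\<close>
definition grade :: "nat \<Rightarrow> 'a::idom poly poly \<Rightarrow> 'a poly poly" where
  "grade c = hom_eval (map_poly (\<lambda>x. [:x:])) (monom (monom 1 1) c)"

lemma comm_ring_hom_map_const_poly: "comm_ring_hom (map_poly (\<lambda>x::'a::idom. [:x:]))"
proof
  fix p q :: "'a poly"
  have const_sum: "[:sum f S:] = (\<Sum>i\<in>S. [:f i:])" for f :: "nat \<Rightarrow> 'a" and S
  proof (induction S rule: infinite_finite_induct)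
    case (insert i S)
    show ?case
      by (simp only: sum.insert[OF insert(1,2)] insert(3)[symmetric]) simp
  qed auto
  show "map_poly (\<lambda>x. [:x:]) (p * q) = map_poly (\<lambda>x. [:x:]) p * map_poly (\<lambda>x. [:x:]) q"
    by (rule poly_eqI) (simp add: coeff_map_poly coeff_mult const_sum mult.commute)
  show "map_poly (\<lambda>x. [:x:]) (p + q) = map_poly (\<lambda>x. [:x:]) p + map_poly (\<lambda>x. [:x:]) q"
    by (rule poly_eqI) (simp add: coeff_map_poly)
  show "map_poly (\<lambda>x::'a. [:x:]) 1 = 1"
    by (rule poly_eqI) (simp add: coeff_map_poly coeff_1)
qed simp

interpretation map_const_poly: comm_ring_hom "map_poly (\<lambda>x::'a::idom. [:x:])"
  by (rule comm_ring_hom_map_const_poly)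

text \<open>Weights become degrees of images under a ring homomorphism, so \<open>grade c\<close>
  can be pulled inside determinants, and weights of products add.\<close>

interpretation grade: comm_ring_hom "grade c :: 'a::idom poly poly \<Rightarrow> 'a poly poly"
  unfolding grade_def by (rule map_const_poly.comm_ring_hom_hom_eval)

text \<open>Here e is the exponent of s and i that of u: the monomial z ^ j t ^ i goes to s ^ (c i +
  j) u ^ i.\<close>

lemma coeff_grade:
  "coeff (coeff (grade c Q) e) i = (if c * i \<le> e then coeff (coeff Q i) (e - c * i) else 0)"
proof -
  have m: "monom (monom (1::'a) 1) c ^ j = monom (monom 1 j) (c * j)" for j
    by (simp add: monom_power mult.commute)
  let ?n = "max (degree Q) i"
  have "grade c Q = (\<Sum>j\<le>?n. monom (monom 1 j) (c * j) * map_poly (\<lambda>x. [:x:]) (coeff Q j))"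
    unfolding grade_def by (subst map_const_poly.hom_eval_altdef[of _ ?n]) (auto simp: m[unfolded One_nat_def] mult.commute)
  then have "coeff (coeff (grade c Q) e) i =
      (\<Sum>j\<le>?n. coeff (coeff (monom (monom 1 j) (c * j) * map_poly (\<lambda>x. [:x:]) (coeff Q j)) e) i)"
    by (simp add: coeff_sum)
  also have "\<dots> = (\<Sum>j\<le>?n. if j = i then (if c * i \<le> e then coeff (coeff Q i) (e - c * i) else 0) else 0)"
    by (rule sum.cong) (auto simp: coeff_monom_mult coeff_map_poly coeff_pCons split: nat.splits)
  finally show ?thesis by simp
qed

lemma grade_eq_0_iff [simp]: "grade c Q = 0 \<longleftrightarrow> Q = 0"
proof
  assume 0: "grade c Q = 0"
  show "Q = 0"
  proof (intro poly_eqI)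
    fix i j
    have "coeff (coeff (grade c Q) (c * i + j)) i = coeff (coeff Q i) j"
      by (simp add: coeff_grade)
    with 0 show "coeff (coeff Q i) j = coeff (coeff 0 i) j" by simp
  qed
qed simp

text \<open>Different monomials have different images under \<open>grade c\<close>, so nothing
  cancels. Vanishing coefficients are excluded because \<open>degree 0 = 0\<close> would wrongly
  demand \<open>c * i \<le> w\<close>.\<close>

lemma degree_grade_le_iff:
  "degree (grade c Q) \<le> w \<longleftrightarrow> (\<forall>i. coeff Q i \<noteq> 0 \<longrightarrow> degree (coeff Q i) + c * i \<le> w)"
proof (intro iffI allI impI)
  fix i assume d: "degree (grade c Q) \<le> w" and nz: "coeff Q i \<noteq> 0"
  have "coeff (coeff (grade c Q) (degree (coeff Q i) + c * i)) i \<noteq> 0"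
    using nz by (simp add: coeff_grade)
  then have "coeff (grade c Q) (degree (coeff Q i) + c * i) \<noteq> 0" by auto
  then show "degree (coeff Q i) + c * i \<le> w" using d le_degree order_trans by blast
next
  assume h: "\<forall>i. coeff Q i \<noteq> 0 \<longrightarrow> degree (coeff Q i) + c * i \<le> w"
  show "degree (grade c Q) \<le> w"
  proof (intro degree_le allI impI poly_eqI)
    fix e i assume "w < e"
    then have "c * i \<le> e \<Longrightarrow> coeff (coeff Q i) (e - c * i) = 0"
      using h[rule_format, of i] by (cases "coeff Q i = 0") (auto intro!: coeff_eq_0)
    then show "coeff (coeff (grade c Q) e) i = coeff 0 i" by (simp add: coeff_grade)
  qed
qed

text \<open>Two weights occur below: 0, which measures the degree in z and so the height, and the
  growth order of integral elements.\<close>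

lemma degree_grade_0: "degree (grade 0 Q) \<le> w \<longleftrightarrow> (\<forall>i. degree (coeff Q i) \<le> w)"
  by (auto simp: degree_grade_le_iff) (metis degree_0 le0)

text \<open>Giving \<open>y\<close> the weight \<open>c - b\<close> makes \<open>t - a y\<close> homogeneous of weight \<open>c\<close>, hence the shape of the
  hypothesis on \<open>P\<close>.\<close>
lemma degree_grade_sum_poly:
  fixes P Q :: "'a::idom poly poly"
  assumes a: "degree a \<le> b"
    and P: "\<And>m. coeff P m \<noteq> 0 \<Longrightarrow> degree (coeff P m) + c * m \<le> e + b * m"
    and Q: "degree (grade c Q) \<le> w"
    and W: "W + c * degree P * degree Q = degree P * w + degree Q * e + b * degree P * degree Q"
  shows "degree (grade c (sum_poly P Q a)) \<le> W"
proof -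
  let ?n = "degree P" and ?D = "degree Q"
  let ?N = "?n + ?D" and ?M = "sum_mat P Q a"
  \<comment> \<open>One column to the right means one more power of y, hence a change of b - c in
    the admissible weight of the entry.\<close>
  define \<kappa> where "\<kappa> = int b - int c"
  define u where "u r = (if r < ?n then int w - \<kappa> * int r else int e - \<kappa> * int (r - ?n))" for r
  have deg: "int (degree (map_mat (grade c) ?M $$ (r, l))) \<le> u r + \<kappa> * int l"
    if "r < ?N" "l < ?N" "map_mat (grade c) ?M $$ (r, l) \<noteq> 0" for r l
  proof -
    have idx: "map_mat (grade c) ?M $$ (r, l) = grade c (?M $$ (r, l))"
      using that sum_mat_carrier[of P Q a] by simp
    show ?thesis
    proof (cases "r < ?n")
      case True
      with that idx have rl: "r \<le> l" and nz: "shear_coeff Q a (l - r) \<noteq> 0"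
        by (auto simp: sum_mat_index split: if_splits)
      define m where "m = l - r"
      have e1: "degree (coeff (shear_coeff Q a m) i) + c * i \<le> nat (int w + \<kappa> * int m)"
        if i: "coeff (shear_coeff Q a m) i \<noteq> 0" for i
      proof -
        have qnz: "coeff Q (m + i) \<noteq> 0" using i by (auto simp: coeff_shear_coeff)
        then have "degree (coeff Q (m + i)) + c * (m + i) \<le> w"
          using Q by (simp add: degree_grade_le_iff)
        moreover have "degree (coeff (shear_coeff Q a m) i) \<le> b * m + degree (coeff Q (m + i))"
        proof -
          have "degree (coeff (shear_coeff Q a m) i) \<le>
              degree (of_nat ((m + i) choose m) * (- a) ^ m) + degree (coeff Q (m + i))"
            unfolding coeff_shear_coeff by (rule degree_mult_le)
          also have "degree (of_nat ((m + i) choose m) * (- a) ^ m) \<le> degree ((- a) ^ m)"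
            using degree_mult_le[of "of_nat ((m + i) choose m)" "(- a) ^ m"] by simp
          also have "degree ((- a) ^ m) \<le> b * m"
            using degree_power_le[of "- a" m] a by (simp add: order_trans[OF _ mult_le_mono1])
          finally show ?thesis by simp
        qed
        ultimately have "int (degree (coeff (shear_coeff Q a m) i) + c * i) \<le> int w + int b * int m - int c * int m"
          by (simp add: algebra_simps flip: of_nat_mult of_nat_add)
        then have "int (degree (coeff (shear_coeff Q a m) i) + c * i) \<le> int w + \<kappa> * int m"
          by (simp add: \<kappa>_def algebra_simps)
        then show ?thesis by linarith
      qed
      \<comment> \<open>Without this, \<open>nat\<close> in the bound just shown could hide a
        negative value.\<close>
      have pos: "int w + \<kappa> * int m \<ge> 0"
      proof -
        obtain i where i: "coeff (shear_coeff Q a m) i \<noteq> 0"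
          using nz m_def by (metis leading_coeff_0_iff)
        then have qnz: "coeff Q (m + i) \<noteq> 0" by (auto simp: coeff_shear_coeff)
        then have "degree (coeff Q (m + i)) + c * (m + i) \<le> w"
          using Q by (simp add: degree_grade_le_iff)
        then have "c * m \<le> w" by (simp add: algebra_simps)
        then have "int c * int m \<le> int w" by (simp flip: of_nat_mult)
        moreover have "0 \<le> int b * int m" by simp
        moreover have "\<kappa> * int m = int b * int m - int c * int m"
          by (simp add: \<kappa>_def algebra_simps)
        ultimately show ?thesis by linarith
      qed
      have "degree (grade c (shear_coeff Q a m)) \<le> nat (int w + \<kappa> * int m)"
        using e1 by (simp add: degree_grade_le_iff)
      then have "int (degree (grade c (shear_coeff Q a m))) \<le> int w + \<kappa> * int m"
        using pos by linarith
      then show ?thesis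
        using that True rl by (simp only: idx)
          (simp add: sum_mat_index u_def m_def of_nat_diff algebra_simps)
    next
      case False
      with that idx have rl: "r - ?n \<le> l" and nz: "coeff P (l - (r - ?n)) \<noteq> 0"
        by (auto simp: sum_mat_index split: if_splits)
      define m where "m = l - (r - ?n)"
      have dP: "degree (coeff P m) + c * m \<le> e + b * m" using P nz m_def by blast
      have "degree (grade c [:coeff P m:]) \<le> degree (coeff P m)"
        by (auto simp: degree_grade_le_iff coeff_pCons split: nat.splits)
      moreover have "int (degree (coeff P m)) \<le> int e + \<kappa> * int m"
        using dP by (simp add: \<kappa>_def algebra_simps flip: of_nat_mult of_nat_add)
      ultimately have "int (degree (grade c [:coeff P m:])) \<le> int e + \<kappa> * int m" by linarith
      moreover have "int m = int l - int (r - ?n)" using rl by (simp add: m_def of_nat_diff)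
      ultimately have "int (degree (grade c [:coeff P m:])) \<le> int e - \<kappa> * int (r - ?n) + \<kappa> * int l"
        by (simp add: algebra_simps)
      then show ?thesis
        using that False rl by (simp only: idx) (simp add: sum_mat_index u_def m_def)
    qed
  qed
  \<comment> \<open>Each of the \<open>?n\<close> rows of Q contributes w and each of the
    \<open>?D\<close> rows of P contributes \<open>int e + \<kappa> * int ?n\<close>; the total is
    the W of the hypothesis, which is stated without subtraction.\<close>
  have "(\<Sum>r<?N. u r + \<kappa> * int r) = (\<Sum>r\<in>{..<?n} \<union> {?n..<?N}. u r + \<kappa> * int r)"
    by (rule sum.cong) auto
  also have "\<dots> = (\<Sum>r<?n. u r + \<kappa> * int r) + (\<Sum>r\<in>{?n..<?N}. u r + \<kappa> * int r)"
    by (rule sum.union_disjoint) auto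
  also have "(\<Sum>r<?n. u r + \<kappa> * int r) = (\<Sum>r<?n. int w)"
    by (rule sum.cong) (auto simp: u_def)
  also have "(\<Sum>r\<in>{?n..<?N}. u r + \<kappa> * int r) = (\<Sum>r\<in>{?n..<?N}. int e + \<kappa> * int ?n)"
    by (rule sum.cong) (auto simp: u_def of_nat_diff algebra_simps)
  also have "(\<Sum>r<?n. int w) + (\<Sum>r\<in>{?n..<?N}. int e + \<kappa> * int ?n) = int W"
    using arg_cong[OF W, of int] by (simp add: \<kappa>_def algebra_simps)
  finally have W': "int W = (\<Sum>r<?N. u r + \<kappa> * int r)" by simp
  have C: "map_mat (grade c) ?M \<in> carrier_mat ?N ?N" using sum_mat_carrier[of P Q a] by simp
  have "degree (det (map_mat (grade c) ?M)) \<le> W"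
    by (rule degree_coeff_det_graded(1)[OF C deg W'])
  then show ?thesis using grade.hom_det[of c ?M] by (simp add: sum_poly_def)
qed

subsection \<open>Annihilating polynomials of power series\<close>

interpretation fps_of_poly: comm_ring_hom "fps_of_poly :: complex poly \<Rightarrow> complex fps"
  by unfold_locales (simp_all add: fps_of_poly_add fps_of_poly_mult)

definition annihilates :: "complex poly poly \<Rightarrow> complex fps \<Rightarrow> bool" where
  "annihilates Q x \<longleftrightarrow> hom_eval fps_of_poly x Q = 0"

lemma annihilates_degree_pos:
  assumes "annihilates Q x" "Q \<noteq> 0"
  shows "degree Q > 0"
proof (rule ccontr)
  assume "\<not> degree Q > 0"
  then obtain q where "Q = [:q:]" using degree_eq_zeroE by blast
  then show False using assms by (simp add: annihilates_def)
qed

lemma annihilates_sum_poly: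
  assumes "annihilates P y" "P \<noteq> 0" "annihilates Q x"
  shows "annihilates (sum_poly P Q a) (x + fps_of_poly a * y)"
  using hom_eval_sum_poly[OF fps_of_poly.comm_ring_hom_axioms annihilates_degree_pos[OF assms(1,2)], of y x Q a]
    assms by (simp add: annihilates_def)

text \<open>The lowest nonzero coefficient works: after cancelling the power of x in front, all the
  other terms are multiples of x.\<close>

lemma dvd_annihilator_coeff:
  assumes "annihilates Q x" "Q \<noteq> 0" "x \<noteq> 0"
  shows "\<exists>i. coeff Q i \<noteq> 0 \<and> x dvd fps_of_poly (coeff Q i)"
  using assms
proof (induction Q)
  case (pCons q Q)
  have eq: "fps_of_poly q + x * hom_eval fps_of_poly x Q = 0"
    using pCons.prems(1) by (simp add: annihilates_def hom_eval_def map_poly_pCons pCons.hyps)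
  show ?case
  proof (cases "q = 0")
    case True
    then have "annihilates Q x" "Q \<noteq> 0" using eq pCons by (auto simp: annihilates_def)
    then obtain i where "coeff Q i \<noteq> 0" "x dvd fps_of_poly (coeff Q i)" using pCons by blast
    then show ?thesis by (intro exI[of _ "Suc i"]) simp
  next
    case False
    have "fps_of_poly q = x * (- hom_eval fps_of_poly x Q)" using eq by (simp add: eq_neg_iff_add_eq_0)
    then have "x dvd fps_of_poly q" by (rule dvdI)
    then show ?thesis using False by (intro exI[of _ 0]) simp
  qed
qed simp

lemma subdegree_fps_of_poly_le: "q \<noteq> 0 \<Longrightarrow> subdegree (fps_of_poly q) \<le> degree q"
  by (rule subdegree_leI) simp

text \<open>A nonzero polynomial divisible by x has at least the order of x at 0, and its order at 0
  is at most its degree.\<close>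

lemma subdegree_le_degree_grade:
  assumes "annihilates Q x" "Q \<noteq> 0" "x \<noteq> 0"
  shows "subdegree x \<le> degree (grade c Q)"
proof -
  obtain i where i: "coeff Q i \<noteq> 0" "x dvd fps_of_poly (coeff Q i)"
    using dvd_annihilator_coeff[OF assms] by blast
  then have "subdegree x \<le> subdegree (fps_of_poly (coeff Q i))"
    using fps_dvd_iff[of x "fps_of_poly (coeff Q i)"] assms by simp
  also have "\<dots> \<le> degree (coeff Q i)" by (rule subdegree_fps_of_poly_le[OF i(1)])
  also have "\<dots> \<le> degree (grade c Q)"
    using degree_grade_le_iff[of c Q "degree (grade c Q)"] i by auto
  finally show ?thesis .
qed

section \<open>Substitutions z -> v(z) in annihilating polynomials\<close>

definition subst_coeffs :: "complex poly \<Rightarrow> complex poly poly \<Rightarrow> complex poly poly" where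
  "subst_coeffs v Q = map_poly (\<lambda>p. pcompose p v) Q"

lemma coeff_subst_coeffs [simp]: "coeff (subst_coeffs v Q) i = pcompose (coeff Q i) v"
  by (simp add: subst_coeffs_def coeff_map_poly)

lemma pcompose_nonconst_eq_0_iff:
  fixes p v :: "complex poly"
  assumes "degree v > 0"
  shows "pcompose p v = 0 \<longleftrightarrow> p = 0"
  using assms pcompose_eq_0 by fastforce

lemma degree_subst_coeffs:
  assumes "degree v > 0"
  shows "degree (subst_coeffs v Q) = degree Q"
proof (cases "Q = 0")
  case False
  have "degree (subst_coeffs v Q) \<le> degree Q"
    by (rule degree_le) (simp add: coeff_eq_0)
  moreover have "coeff (subst_coeffs v Q) (degree Q) \<noteq> 0"
    using False assms by (simp add: pcompose_nonconst_eq_0_iff)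
  ultimately show ?thesis using le_degree by (blast intro: antisym)
qed (simp add: subst_coeffs_def)

lemma subst_coeffs_eq_0_iff:
  assumes "degree v > 0"
  shows "subst_coeffs v Q = 0 \<longleftrightarrow> Q = 0"
proof
  assume "subst_coeffs v Q = 0"
  then have "pcompose (coeff Q i) v = 0" for i by (metis coeff_0 coeff_subst_coeffs)
  then show "Q = 0" using assms by (intro poly_eqI) (simp add: pcompose_nonconst_eq_0_iff)
qed (simp add: subst_coeffs_def)

lemma annihilates_subst_coeffs:
  assumes "annihilates Q x" "coeff v 0 = 0"
  shows "annihilates (subst_coeffs v Q) (x oo fps_of_poly v)"
proof -
  have v0: "fps_of_poly v $ 0 = 0" using assms by simp
  have "hom_eval fps_of_poly (x oo fps_of_poly v) (subst_coeffs v Q) =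
      (\<Sum>i\<le>degree Q. fps_of_poly (pcompose (coeff Q i) v) * (x oo fps_of_poly v) ^ i)"
    by (subst fps_of_poly.hom_eval_altdef[of _ "degree Q"])
      (auto intro!: degree_le simp: coeff_eq_0)
  also have "\<dots> = (\<Sum>i\<le>degree Q. (fps_of_poly (coeff Q i) * x ^ i) oo fps_of_poly v)"
    using v0 assms by (simp add: fps_of_poly_pcompose fps_compose_mult_distrib fps_compose_power)
  also have "\<dots> = hom_eval fps_of_poly x Q oo fps_of_poly v"
    by (simp add: fps_of_poly.hom_eval_altdef[OF order_refl] fps_compose_sum_distrib)
  finally show ?thesis using assms by (simp add: annihilates_def)
qed

text \<open>Induction on e, one resultant per term: the degree in y is multiplied by n each time.
  The weight w itself is e A n ^ e + n ^ (e - 1) h (1 + ... + k ^ (e - 1)) for e > 0; giving the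
  value of \<open>n * w\<close> avoids the exponent e - 1.\<close>

lemma annihilator_mahler_combination:
  fixes a :: "nat \<Rightarrow> complex poly" and k n h A e :: nat
  assumes P: "annihilates P G" "P \<noteq> 0" and n: "degree P = n" and h: "degree (grade 0 P) \<le> h"
    and a: "\<And>i. i < e \<Longrightarrow> degree (a i) \<le> A" and k: "k > 0"
  shows "\<exists>Q w. Q \<noteq> 0 \<and> annihilates Q (\<Sum>i<e. fps_of_poly (a i) * (G oo fps_X ^ (k ^ i))) \<and>
    degree Q = n ^ e \<and> degree (grade 0 Q) \<le> w \<and>
    n * w = e * A * n ^ Suc e + n ^ e * h * (\<Sum>i<e. k ^ i)"
  using a
proof (induction e)
  case 0
  have "annihilates [:0, 1:] 0" by (simp add: annihilates_def hom_eval_def map_poly_pCons)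
  moreover have "degree (grade 0 [:0, 1 :: complex poly:]) \<le> 0"
    by (subst degree_grade_0) (auto simp: coeff_pCons split: nat.splits)
  ultimately show ?case by (intro exI[of _ "[:0, 1:]"] exI[of _ 0]) auto
next
  case (Suc e)
  then obtain Q w where Q: "Q \<noteq> 0" "annihilates Q (\<Sum>i<e. fps_of_poly (a i) * (G oo fps_X ^ (k ^ i)))"
    "degree Q = n ^ e" "degree (grade 0 Q) \<le> w"
    and w: "n * w = e * A * n ^ Suc e + n ^ e * h * (\<Sum>i<e. k ^ i)"
    by (meson less_SucI)
  define v where "v = monom (1::complex) (k ^ e)"
  have v: "degree v = k ^ e" "degree v > 0" "coeff v 0 = 0" "fps_of_poly v = fps_X ^ (k ^ e)"
    using k by (auto simp: v_def degree_monom_eq fps_of_poly_monom')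
  define P' where "P' = subst_coeffs v P"
  have P': "annihilates P' (G oo fps_X ^ (k ^ e))" "P' \<noteq> 0" "degree P' = n"
    using annihilates_subst_coeffs[OF P(1) v(3)] v P n
    by (auto simp: P'_def subst_coeffs_eq_0_iff degree_subst_coeffs)
  have dP: "degree (coeff P' m) \<le> h * k ^ e" for m
    using h v by (auto simp: P'_def degree_pcompose degree_grade_0 intro!: mult_le_mono1)
  \<comment> \<open>\<open>?W\<close> is what \<open>degree_grade_sum_poly\<close> yields for c = 0:
    the coefficients of \<open>P'\<close> have degree at most \<open>h * k ^ e\<close>, those of Q
    at most w, and \<open>a e\<close> at most A.\<close>
  let ?R = "sum_poly P' Q (a e)" and ?W = "n * w + n ^ e * (h * k ^ e) + A * n * n ^ e"
  have "degree (grade 0 ?R) \<le> ?W"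
    by (rule degree_grade_sum_poly[where b = A and w = w and e = "h * k ^ e"])
      (use Suc.prems dP Q P' in \<open>auto intro: trans_le_add1\<close>)
  moreover have "n * ?W = Suc e * A * n ^ Suc (Suc e) + n ^ Suc e * h * (\<Sum>i<Suc e. k ^ i)"
    unfolding distrib_left w by (simp add: algebra_simps)
  moreover have "annihilates ?R (\<Sum>i<Suc e. fps_of_poly (a i) * (G oo fps_X ^ (k ^ i)))"
    using annihilates_sum_poly[OF P'(1,2) Q(2)] by simp
  moreover have "?R \<noteq> 0" "degree ?R = n ^ Suc e"
    using degree_sum_poly[OF P'(2) Q(1), of "a e"] Q P' by auto
  ultimately show ?case by blast
qed

text \<open>Let i be minimal with \<open>a i \<noteq> 0\<close> and v the order of W. Term i has
  order at most A + k ^ i v, all later terms at least k ^ (i + 1) v. Since they cancel, v \<le> (k -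
  1) k ^ i v \<le> A.\<close>

lemma subdegree_mahler_solution:
  fixes a :: "nat \<Rightarrow> complex poly"
  assumes eq: "(\<Sum>i\<le>d. fps_of_poly (a i) * (W oo fps_X ^ (k ^ i))) = 0"
    and a: "\<And>i. i \<le> d \<Longrightarrow> degree (a i) \<le> A" and nz: "\<exists>i\<le>d. a i \<noteq> 0"
    and k: "k \<ge> 2" and W: "W \<noteq> 0"
  shows "subdegree W \<le> A"
proof -
  define v where "v = subdegree W"
  define i where "i = (LEAST i. a i \<noteq> 0)"
  obtain i0 where i0: "i0 \<le> d" "a i0 \<noteq> 0" using nz by blast
  have i: "a i \<noteq> 0" "i \<le> d"
    unfolding i_def using LeastI[of "\<lambda>i. a i \<noteq> 0", OF i0(2)] Least_le[of "\<lambda>i. a i \<noteq> 0", OF i0(2)] i0(1)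
    by auto
  have i_least: "a j = 0" if "j < i" for j
    using not_less_Least[of j "\<lambda>i. a i \<noteq> 0"] that by (auto simp: i_def)
  have sub: "subdegree (W oo fps_X ^ (k ^ j)) = k ^ j * v" "W oo fps_X ^ (k ^ j) \<noteq> 0" for j
  proof -
    have kj: "k ^ j > 0" using k by simp
    have nz: "(W oo fps_X ^ (k ^ j)) $ (k ^ j * v) \<noteq> 0"
      using kj W by (simp add: fps_nth_compose_X_power v_def)
    show "subdegree (W oo fps_X ^ (k ^ j)) = k ^ j * v"
    proof (rule subdegreeI)
      show "(W oo fps_X ^ (k ^ j)) $ (k ^ j * v) \<noteq> 0" by (rule nz)
      fix l assume "l < k ^ j * v"
      then show "(W oo fps_X ^ (k ^ j)) $ l = 0"
      proof -
        have "l div k ^ j < subdegree W"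
          using \<open>l < k ^ j * v\<close> less_mult_imp_div_less[of l v "k ^ j"] by (simp add: mult.commute v_def)
        then have "W $ (l div k ^ j) = 0" by (rule nth_less_subdegree_zero)
        then show ?thesis by (simp only: fps_nth_compose_X_power if_cancel)
      qed
    qed
    show "W oo fps_X ^ (k ^ j) \<noteq> 0"
      using nz fps_zero_nth by metis
  qed
  show ?thesis
  proof (cases "v = 0")
    case False
    have "(\<Sum>j\<le>d. fps_of_poly (a j) * (W oo fps_X ^ (k ^ j))) =
        fps_of_poly (a i) * (W oo fps_X ^ (k ^ i)) +
        (\<Sum>j\<in>{..d} - {i}. fps_of_poly (a j) * (W oo fps_X ^ (k ^ j)))"
      using i(2) by (simp add: sum.remove)
    also have "(\<Sum>j\<in>{..d} - {i}. fps_of_poly (a j) * (W oo fps_X ^ (k ^ j))) =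
        (\<Sum>j\<in>{i<..d}. fps_of_poly (a j) * (W oo fps_X ^ (k ^ j)))"
      using i_least by (intro sum.mono_neutral_right) (auto simp: not_less le_less)
    finally have e: "fps_of_poly (a i) * (W oo fps_X ^ (k ^ i)) =
        - (\<Sum>j\<in>{i<..d}. fps_of_poly (a j) * (W oo fps_X ^ (k ^ j)))"
      using eq by (simp add: eq_neg_iff_add_eq_0)
    let ?L = "fps_of_poly (a i) * (W oo fps_X ^ (k ^ i))"
    have "?L \<noteq> 0" using sub i by simp
    have "subdegree ?L \<ge> k ^ Suc i * v"
    proof (rule subdegree_geI[OF \<open>?L \<noteq> 0\<close>])
      fix l assume l: "l < k ^ Suc i * v"
      have "(fps_of_poly (a j) * (W oo fps_X ^ (k ^ j))) $ l = 0" if "j > i" for j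
      proof (cases "a j = 0")
        case False
        have "k ^ Suc i \<le> k ^ j" using that k by (intro power_increasing) auto
        then have "k ^ Suc i * v \<le> k ^ j * v" by (rule mult_le_mono1)
        moreover have "subdegree (fps_of_poly (a j) * (W oo fps_X ^ (k ^ j))) =
            subdegree (fps_of_poly (a j)) + k ^ j * v"
          using sub False by simp
        ultimately have "l < subdegree (fps_of_poly (a j) * (W oo fps_X ^ (k ^ j)))"
          using l by linarith
        then show ?thesis by (rule nth_less_subdegree_zero)
      qed simp
      then show "?L $ l = 0" unfolding e by (simp add: fps_sum_nth)
    qed
    moreover have "subdegree ?L \<le> A + k ^ i * v"
      using sub i a[of i] subdegree_fps_of_poly_le[OF i(1)] by simp
    moreover have "k ^ Suc i * v \<ge> k ^ i * v + v"
    proof -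
      have "1 * v \<le> k ^ i * v" using k by (intro mult_le_mono1) simp
      moreover have "2 * (k ^ i * v) \<le> k * (k ^ i * v)" using k by (rule mult_le_mono1)
      ultimately show ?thesis unfolding power_Suc mult.assoc by linarith
    qed
    ultimately show ?thesis by (simp add: v_def)
  qed (simp add: v_def)
qed

lemma subdegree_diff_le:
  fixes a :: "nat \<Rightarrow> complex poly"
  assumes P: "annihilates P G" "P \<noteq> 0" and n: "degree P = n" and h: "degree (grade 0 P) \<le> h"
    and eq: "(\<Sum>i\<le>d. fps_of_poly (a i) * (F oo fps_X ^ (k ^ i))) = 0"
    and a: "\<And>i. i \<le> d \<Longrightarrow> degree (a i) \<le> A" and nz: "\<exists>i\<le>d. a i \<noteq> 0"
    and k: "k \<ge> 2" and FG: "F \<noteq> G"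
  shows "subdegree (F - G) \<le> (d + 1) * A * n ^ (d + 1) + (\<Sum>i\<le>d. k ^ i) * h * n ^ d"
proof -
  let ?T = "\<lambda>x. \<Sum>i\<le>d. fps_of_poly (a i) * (x oo fps_X ^ (k ^ i))"
  have n0: "n > 0" using annihilates_degree_pos[OF P] n by simp
  have lin: "?T (F - G) = - ?T G"
    using eq by (simp add: fps_compose_sub_distrib right_diff_distrib sum_subtractf)
  show ?thesis
  proof (cases "?T G = 0")
    case True
    then have "subdegree (F - G) \<le> A"
      using subdegree_mahler_solution[where d = d and a = a and W = "F - G" and k = k and A = A] lin a nz k FG by simp
    \<comment> \<open>Here n > 0, as a nonzero annihilating polynomial is not constant, so the first
      summand of the bound is at least A.\<close>
    also have "A \<le> A * ((d + 1) * n ^ (d + 1))"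
    proof -
      have "(d + 1) * n ^ (d + 1) > 0" using n0 by simp
      then show ?thesis by (cases "(d + 1) * n ^ (d + 1)") (simp_all only: mult_Suc_right le_add1 less_irrefl)
    qed
    also have "\<dots> \<le> (d + 1) * A * n ^ (d + 1) + (\<Sum>i\<le>d. k ^ i) * h * n ^ d"
      by (simp only: mult_ac le_add1)
    finally show ?thesis .
  next
    case False
    \<comment> \<open>The sum over \<open>i \<le> d\<close> is the one over
      \<open>i < Suc d\<close>, hence e = d + 1; the factor n on both sides is cancelled at the
      end.\<close>
    obtain Q w where Q: "Q \<noteq> 0" "annihilates Q (?T G)" "degree (grade 0 Q) \<le> w"
      and w: "n * w = Suc d * A * n ^ Suc (Suc d) + n ^ Suc d * h * (\<Sum>i<Suc d. k ^ i)"
      using annihilator_mahler_combination[OF P n h, of "Suc d" a A k] a k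
      by (auto simp: lessThan_Suc_atMost less_Suc_eq_le)
    \<comment> \<open>By \<open>lin\<close> it suffices that no term of \<open>?T (F - G)\<close>
      has smaller order than F - G: the substitution z -> z ^ (k ^ i) does not lower orders.\<close>
    have "subdegree (F - G) \<le> subdegree (?T G)"
    proof (rule subdegree_geI[OF False])
      fix l assume l: "l < subdegree (F - G)"
      have "((F - G) oo fps_X ^ (k ^ i)) $ m = 0" if "m \<le> l" for i m
      proof -
        have "m div k ^ i < subdegree (F - G)" using that l by (meson div_le_dividend le_less_trans)
        then have "(F - G) $ (m div k ^ i) = 0" by (rule nth_less_subdegree_zero)
        then show ?thesis by (simp only: fps_nth_compose_X_power if_cancel)
      qed
      then have "?T (F - G) $ l = 0" by (simp add: fps_sum_nth fps_mult_nth)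
      then show "?T G $ l = 0" by (simp only: lin fps_neg_nth neg_equal_0_iff_equal)
    qed
    also have "\<dots> \<le> w" using subdegree_le_degree_grade[OF Q(2,1) False] Q(3) order_trans by blast
    also have "w = (d + 1) * A * n ^ (d + 1) + (\<Sum>i\<le>d. k ^ i) * h * n ^ d"
    proof -
      have "n * w = n * ((d + 1) * A * n ^ (d + 1) + (\<Sum>i\<le>d. k ^ i) * h * n ^ d)"
        unfolding w lessThan_Suc_atMost by (simp only: distrib_left power_Suc mult_ac Suc_eq_plus1)
          (simp add: algebra_simps)
      then show ?thesis using n0 by simp
    qed
    finally show ?thesis .
  qed
qed

subsection \<open>Integral elements\<close>

text \<open>Integrality over \<open>\<complex>[z]\<close>, with all conjugates of growth at most \<open>\<bar>z\<bar> ^ c\<close> at infinity.\<close>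
definition integral_of_order :: "nat \<Rightarrow> complex fps \<Rightarrow> bool" where
  "integral_of_order c x \<longleftrightarrow>
     (\<exists>Q. annihilates Q x \<and> lead_coeff Q = 1 \<and> degree (grade c Q) \<le> c * degree Q)"

lemma integral_of_order_0: "integral_of_order c 0"
  unfolding integral_of_order_def
proof (intro exI[of _ "[:0, 1:]"] conjI)
  show "annihilates [:0, 1:] 0" by (simp add: annihilates_def hom_eval_def map_poly_pCons)
  show "degree (grade c [:0, 1 :: complex poly:]) \<le> c * degree [:0, 1 :: complex poly:]"
    by (subst degree_grade_le_iff) (auto simp: coeff_pCons split: nat.splits)
qed simp

text \<open>With a constant s the resultant is monic again, and the weights balance: b = 0 and the
  bounds c D and c n for degrees D and n give c n D, which is c times its degree.\<close>

lemma integral_of_order_add_smult: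
  assumes "integral_of_order c x" "integral_of_order c y"
  shows "integral_of_order c (x + fps_const s * y)"
proof -
  from assms obtain P Q where P: "annihilates P y" "lead_coeff P = 1" "degree (grade c P) \<le> c * degree P"
    and Q: "annihilates Q x" "lead_coeff Q = 1" "degree (grade c Q) \<le> c * degree Q"
    by (auto simp: integral_of_order_def)
  have nz: "P \<noteq> 0" "Q \<noteq> 0" using P Q by auto
  let ?R = "sum_poly P Q [:s:]"
  have "annihilates ?R (x + fps_const s * y)"
    using annihilates_sum_poly[OF P(1) nz(1) Q(1), of "[:s:]"] by (simp add: fps_of_poly_const)
  moreover have "lead_coeff ?R = 1" "degree ?R = degree P * degree Q"
    using degree_sum_poly[OF nz] P Q by simp_all
  moreover have "degree (grade c ?R) \<le> c * (degree P * degree Q)"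
    by (rule degree_grade_sum_poly[where b = 0 and w = "c * degree Q" and e = "c * degree P"])
      (use P(3) Q(3) in \<open>auto simp: degree_grade_le_iff[of c P] algebra_simps\<close>)
  ultimately show ?thesis unfolding integral_of_order_def by metis
qed

lemma integral_of_order_sum:
  assumes "finite S" "\<And>i. i \<in> S \<Longrightarrow> integral_of_order c (x i)"
  shows "integral_of_order c (\<Sum>i\<in>S. fps_const (s i) * x i)"
  using assms
proof (induction S rule: finite_induct)
  case (insert i S)
  then show ?case
    using integral_of_order_add_smult[of c "\<Sum>i\<in>S. fps_const (s i) * x i" "x i" "s i"]
    by (simp add: add.commute)
qed (simp add: integral_of_order_0)

lemma integral_of_order_scale:
  assumes "integral_of_order c x" "\<omega> \<noteq> 0"
  shows "integral_of_order c (x oo fps_of_poly [:0, \<omega>:])"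
proof -
  from assms obtain Q where Q: "annihilates Q x" "lead_coeff Q = 1" "degree (grade c Q) \<le> c * degree Q"
    by (auto simp: integral_of_order_def)
  let ?v = "[:0, \<omega>:]"
  let ?Q = "subst_coeffs ?v Q"
  have d: "degree ?v = 1" using assms by simp
  have "annihilates ?Q (x oo fps_of_poly ?v)"
    by (rule annihilates_subst_coeffs[OF Q(1)]) simp
  moreover have dQ: "degree ?Q = degree Q" using d by (intro degree_subst_coeffs) simp
  moreover have "lead_coeff ?Q = 1" using Q by (simp only: dQ coeff_subst_coeffs) (simp add: pcompose_1)
  moreover have "degree (grade c ?Q) \<le> c * degree Q"
    unfolding degree_grade_le_iff
  proof (intro allI impI)
    fix i assume "coeff ?Q i \<noteq> 0"
    then have "coeff Q i \<noteq> 0" by auto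
    then show "degree (coeff ?Q i) + c * i \<le> c * degree Q"
      using Q(3) unfolding coeff_subst_coeffs degree_pcompose d by (simp add: degree_grade_le_iff)
  qed
  ultimately show ?thesis unfolding integral_of_order_def by metis
qed

text \<open>Multiplying P(x) = 0 by p ^ m, where p is the leading coefficient and m + 1 the degree,
  gives a monic equation for p x. Its coefficient \<open>coeff P i * ?p ^ (m - i)\<close> has degree
  at most h (m + 1 - i), as the weight h requires.\<close>

lemma integral_of_order_lead_coeff_mult:
  assumes P: "annihilates P x" "P \<noteq> 0" and h: "degree (grade 0 P) \<le> h"
  shows "integral_of_order h (fps_of_poly (lead_coeff P) * x)"
proof -
  let ?p = "lead_coeff P"
  obtain m where m: "degree P = Suc m" using annihilates_degree_pos[OF P] gr0_implies_Suc by blast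
  define Q where "Q = monom 1 (Suc m) + (\<Sum>i\<le>m. monom (coeff P i * ?p ^ (m - i)) i)"
  have cQ: "coeff Q i = (if i = Suc m then 1 else if i \<le> m then coeff P i * ?p ^ (m - i) else 0)" for i
    by (auto simp: Q_def coeff_sum coeff_monom)
  have dQ: "degree Q = Suc m"
    by (rule antisym[OF degree_le le_degree]) (auto simp: cQ)
  have hP: "degree (coeff P i) \<le> h" for i using h by (simp add: degree_grade_0)
  let ?y = "fps_of_poly ?p * x"
  have "hom_eval fps_of_poly ?y Q = (\<Sum>i\<le>Suc m. fps_of_poly (coeff Q i) * ?y ^ i)"
    by (rule fps_of_poly.hom_eval_altdef) (simp add: dQ)
  also have "\<dots> = (\<Sum>i\<le>m. fps_of_poly (coeff P i * ?p ^ (m - i)) * ?y ^ i) + ?y ^ Suc m"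
    by (simp add: cQ)
  also have "(\<Sum>i\<le>m. fps_of_poly (coeff P i * ?p ^ (m - i)) * ?y ^ i) =
      (\<Sum>i\<le>m. fps_of_poly ?p ^ m * (fps_of_poly (coeff P i) * x ^ i))"
  proof (rule sum.cong)
    fix i assume "i \<in> {..m}"
    then have "fps_of_poly ?p ^ m = fps_of_poly ?p ^ (m - i) * fps_of_poly ?p ^ i"
      by (simp flip: power_add)
    then show "fps_of_poly (coeff P i * ?p ^ (m - i)) * ?y ^ i =
        fps_of_poly ?p ^ m * (fps_of_poly (coeff P i) * x ^ i)"
      by (simp add: fps_of_poly_mult fps_of_poly_power power_mult_distrib mult_ac)
  qed simp
  also have "\<dots> + ?y ^ Suc m = fps_of_poly ?p ^ m * (\<Sum>i\<le>Suc m. fps_of_poly (coeff P i) * x ^ i)"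
    by (simp add: sum_distrib_left distrib_left power_mult_distrib mult_ac m)
  also have "(\<Sum>i\<le>Suc m. fps_of_poly (coeff P i) * x ^ i) = 0"
    using P(1) fps_of_poly.hom_eval_altdef[of P "Suc m" x] m by (simp add: annihilates_def)
  finally have "annihilates Q ?y" by (simp add: annihilates_def)
  moreover have "lead_coeff Q = 1" by (simp add: dQ cQ)
  moreover have "degree (grade h Q) \<le> h * degree Q"
    unfolding degree_grade_le_iff dQ
  proof (intro allI impI)
    fix i assume "coeff Q i \<noteq> 0"
    then consider "i = Suc m" | "i \<le> m" by (auto simp: cQ split: if_splits)
    then show "degree (coeff Q i) + h * i \<le> h * Suc m"
    proof cases
      case 1
      then show ?thesis by (simp add: cQ)
    next
      case 2
      then have "degree (coeff Q i) \<le> degree (coeff P i) + degree (?p ^ (m - i))"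
        by (simp add: cQ degree_mult_le)
      also have "\<dots> \<le> h + h * (m - i)"
        using hP[of i] hP[of "degree P"] degree_power_le[of ?p "m - i"]
        by (meson add_le_mono le_trans mult_le_mono1)
      finally have "degree (coeff Q i) + h * i \<le> h + h * (m - i + i)"
        by (simp only: add_mult_distrib2)
      then show ?thesis using 2 by simp
    qed
  qed
  ultimately show ?thesis unfolding integral_of_order_def by blast
qed

text \<open>Gauss's lemma: contents multiply, so a divides the content of the cofactor of S and can
  be cancelled there.\<close>

lemma primitive_dvd_smult:
  fixes S Q :: "complex poly poly"
  assumes "content S = 1" "a \<noteq> 0" "S dvd Polynomial.smult a Q"
  shows "S dvd Q"
proof -
  obtain T where T: "Polynomial.smult a Q = S * T" using assms(3) by (elim dvdE)
  have "a dvd content (Polynomial.smult a Q)" by (simp add: content_smult)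
  also have "content (Polynomial.smult a Q) = content T" unfolding T by (simp add: content_mult assms)
  finally have "[:a:] dvd T" by (simp add: const_poly_dvd_iff_dvd_content)
  then obtain T' where "T = [:a:] * T'" by (elim dvdE)
  then have "Polynomial.smult a Q = Polynomial.smult a (S * T')" using T by simp
  then have "Q = S * T'" using assms(2) by (metis smult_cancel)
  then show ?thesis by simp
qed

text \<open>The minimal polynomial of an integral element inherits the bounds on the coefficients, by Gauss's
  lemma and additivity of weights.\<close>
lemma subdegree_integral_le:
  assumes "integral_of_order c x" and S: "annihilates S x" "S \<noteq> 0" and x: "x \<noteq> 0"
  shows "subdegree x \<le> c * degree S"
proof -
  from assms obtain Q where Q: "annihilates Q x" "lead_coeff Q = 1" "degree (grade c Q) \<le> c * degree Q"
    by (auto simp: integral_of_order_def)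
  interpret e: comm_ring_hom "hom_eval fps_of_poly x"
    by (rule fps_of_poly.comm_ring_hom_hom_eval)
  obtain S0 where S0: "annihilates S0 x" "S0 \<noteq> 0" and "degree S0 \<le> degree S"
    and min: "\<And>T. annihilates T x \<Longrightarrow> T \<noteq> 0 \<Longrightarrow> degree S0 \<le> degree T"
    using ex_has_least_nat[of "\<lambda>S. annihilates S x \<and> S \<noteq> 0" S degree] S by blast
  define S1 where "S1 = primitive_part S0"
  have S0_eq: "S0 = [:content S0:] * S1" by (simp add: S1_def)
  have c0: "content S0 \<noteq> 0" using S0 by simp
  have S1: "annihilates S1 x" "S1 \<noteq> 0" "content S1 = 1" "degree S1 = degree S0"
  proof -
    have "hom_eval fps_of_poly x S0 = fps_of_poly (content S0) * hom_eval fps_of_poly x S1"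
      by (subst S0_eq) (simp only: e.hom_mult fps_of_poly.hom_eval_const)
    then show "annihilates S1 x" using S0 c0 by (simp add: annihilates_def)
  qed (use S0 in \<open>simp_all add: S1_def\<close>)
  obtain b q where b: "b \<noteq> 0" "Polynomial.smult b Q = S1 * q + pseudo_mod Q S1"
    and r: "pseudo_mod Q S1 = 0 \<or> degree (pseudo_mod Q S1) < degree S1"
    using pseudo_mod[OF S1(2), of Q] by blast
  have "Polynomial.smult b Q = [:b:] * Q" by simp
  then have "hom_eval fps_of_poly x ([:b:] * Q) = hom_eval fps_of_poly x (S1 * q + pseudo_mod Q S1)"
    using b by simp
  then have "annihilates (pseudo_mod Q S1) x"
    using Q(1) S1(1) by (simp only: e.hom_mult e.hom_add annihilates_def) simp
  then have "pseudo_mod Q S1 = 0" using r min S1(4) by (metis not_less)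
  then have "S1 dvd Q" using primitive_dvd_smult[OF S1(3) b(1), of Q] b(2) by simp
  then obtain T where T: "Q = S1 * T" by (elim dvdE)
  have Q0: "Q \<noteq> 0" using Q(2) by auto
  then have T0: "T \<noteq> 0" using T by auto
  \<comment> \<open>Weights add over Q = S1 T, and the leading term alone gives T weight at least c
    times its degree; hence \<open>S1\<close> has weight at most c times its degree.\<close>
  have "degree (grade c Q) = degree (grade c S1) + degree (grade c T)"
    unfolding T grade.hom_mult using S1 T0 by (simp add: degree_mult_eq)
  moreover have "degree (lead_coeff T) + c * degree T \<le> degree (grade c T)"
    using degree_grade_le_iff[of c T "degree (grade c T)"] T0 by simp
  moreover have "degree Q = degree S1 + degree T" using T S1 T0 by (simp add: degree_mult_eq)
  ultimately have "degree (grade c S1) \<le> c * degree S1" using Q(3) by (simp add: algebra_simps)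
  then have "subdegree x \<le> c * degree S1"
    using subdegree_le_degree_grade[OF S1(1,2) x, of c] by simp
  also have "\<dots> \<le> c * degree S" using S1 \<open>degree S0 \<le> degree S\<close> by simp
  finally show ?thesis .
qed

subsection \<open>Algebraic Mahler functions are rational\<close>

text \<open>This is the span of S over C(z), intersected with the power series;
  \<open>cancel\<close> takes the place of division, so that no fractions appear.\<close>

inductive_set rational_span :: "complex fps set \<Rightarrow> complex fps set" for S where
  base: "x \<in> S \<Longrightarrow> x \<in> rational_span S"
| zero: "0 \<in> rational_span S"
| add: "x \<in> rational_span S \<Longrightarrow> y \<in> rational_span S \<Longrightarrow> x + y \<in> rational_span S"
| mult: "x \<in> rational_span S \<Longrightarrow> fps_of_poly p * x \<in> rational_span S"
| cancel: "fps_of_poly q * x \<in> rational_span S \<Longrightarrow> q \<noteq> 0 \<Longrightarrow> x \<in> rational_span S"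

lemma rational_span_subset:
  assumes "S \<subseteq> rational_span T" "x \<in> rational_span S"
  shows "x \<in> rational_span T"
  using assms(2) by induction (use assms(1) in \<open>auto intro: rational_span.intros\<close>)

lemma rational_span_sum:
  "(\<And>i. i \<in> I \<Longrightarrow> x i \<in> rational_span S) \<Longrightarrow> (\<Sum>i\<in>I. x i) \<in> rational_span S"
  by (induction I rule: infinite_finite_induct) (auto intro: rational_span.intros)

lemma rational_span_uminus:
  assumes "x \<in> rational_span S"
  shows "- x \<in> rational_span S"
  using rational_span.mult[OF assms, of "- 1"] by (simp add: fps_of_poly_uminus)

lemma rational_span_compose:
  assumes "x \<in> rational_span S" "degree v > 0" "coeff v 0 = 0"
  shows "x oo fps_of_poly v \<in> rational_span ((\<lambda>x. x oo fps_of_poly v) ` S)"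
  using assms(1)
proof induction
  case (mult x p)
  have "fps_of_poly p * x oo fps_of_poly v = fps_of_poly (pcompose p v) * (x oo fps_of_poly v)"
    using assms by (simp add: fps_of_poly_pcompose fps_compose_mult_distrib)
  then show ?case using mult by (simp add: rational_span.mult)
next
  case (cancel q x)
  have "fps_of_poly q * x oo fps_of_poly v = fps_of_poly (pcompose q v) * (x oo fps_of_poly v)"
    using assms by (simp add: fps_of_poly_pcompose fps_compose_mult_distrib)
  then show ?case
    using cancel assms by (metis pcompose_nonconst_eq_0_iff rational_span.cancel)
qed (auto intro: rational_span.intros simp: fps_compose_add_distrib)

text \<open>The denominators introduced by \<open>cancel\<close> are collected into one b.\<close>

lemma rational_span_normal_form:
  fixes e :: nat
  assumes "x \<in> rational_span (g ` {..<e})"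
  shows "\<exists>b c. b \<noteq> 0 \<and> fps_of_poly b * x = (\<Sum>j<e. fps_of_poly (c j) * g j)"
  using assms
proof induction
  case (base x)
  then obtain i where i: "i < e" "x = g i" by auto
  have "(\<Sum>j<e. fps_of_poly (if j = i then 1 else 0) * g j) = (\<Sum>j<e. if j = i then g j else 0)"
    by (rule sum.cong) auto
  also have "\<dots> = g i" using i sum.delta[of "{..<e}" i g] by simp
  finally show ?case
    using i by (intro exI[of _ 1] exI[of _ "\<lambda>j. if j = i then 1 else 0"]) simp
next
  case zero
  then show ?case by (intro exI[of _ 1] exI[of _ "\<lambda>_. 0"]) simp
next
  case (add x y)
  then obtain b c b' c' where "b \<noteq> 0" "fps_of_poly b * x = (\<Sum>j<e. fps_of_poly (c j) * g j)"
    "b' \<noteq> 0" "fps_of_poly b' * y = (\<Sum>j<e. fps_of_poly (c' j) * g j)" by blast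
  moreover have "fps_of_poly (b * b') * (x + y) =
      fps_of_poly b' * (fps_of_poly b * x) + fps_of_poly b * (fps_of_poly b' * y)"
    by (simp add: fps_of_poly_mult algebra_simps)
  ultimately have "b * b' \<noteq> 0 \<and>
      fps_of_poly (b * b') * (x + y) = (\<Sum>j<e. fps_of_poly (b' * c j + b * c' j) * g j)"
    by (simp add: fps_of_poly_mult fps_of_poly_add sum_distrib_left sum.distrib algebra_simps)
  then show ?case by (intro exI[of _ "b * b'"] exI[of _ "\<lambda>j. b' * c j + b * c' j"])
next
  case (mult x p)
  then obtain b c where "b \<noteq> 0" "fps_of_poly b * x = (\<Sum>j<e. fps_of_poly (c j) * g j)" by blast
  moreover have "fps_of_poly b * (fps_of_poly p * x) = fps_of_poly p * (fps_of_poly b * x)"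
    by (simp add: mult_ac)
  ultimately have "b \<noteq> 0 \<and> fps_of_poly b * (fps_of_poly p * x) = (\<Sum>j<e. fps_of_poly (p * c j) * g j)"
    by (simp add: fps_of_poly_mult sum_distrib_left mult.assoc)
  then show ?case by (intro exI[of _ b] exI[of _ "\<lambda>j. p * c j"])
next
  case (cancel q x)
  then obtain b c where "b \<noteq> 0" "fps_of_poly b * (fps_of_poly q * x) = (\<Sum>j<e. fps_of_poly (c j) * g j)"
    by blast
  with cancel have "b * q \<noteq> 0 \<and> fps_of_poly (b * q) * x = (\<Sum>j<e. fps_of_poly (c j) * g j)"
    by (simp add: fps_of_poly_mult mult.assoc)
  then show ?case by (intro exI[of _ "b * q"] exI[of _ c])
qed

text \<open>The witness is Q (b y), whose degree in y is that of Q since b is not 0.\<close>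

lemma annihilates_cancel:
  assumes "annihilates Q (fps_of_poly b * x)" "Q \<noteq> 0" "b \<noteq> 0"
  shows "\<exists>Q'. annihilates Q' x \<and> Q' \<noteq> 0 \<and> degree Q' = degree Q"
proof -
  interpret ex: comm_ring_hom "hom_eval fps_of_poly x"
    by (rule fps_of_poly.comm_ring_hom_hom_eval)
  interpret ebx: comm_ring_hom "hom_eval fps_of_poly (fps_of_poly b * x)"
    by (rule fps_of_poly.comm_ring_hom_hom_eval)
  have t: "hom_eval fps_of_poly x [:0, b:] = fps_of_poly b * x"
    by (simp add: hom_eval_def map_poly_pCons mult.commute)
  have "hom_eval fps_of_poly x (pcompose Q [:0, b:]) = hom_eval fps_of_poly (fps_of_poly b * x) Q"
  proof (induction Q)
    case (pCons a Q)
    have "hom_eval fps_of_poly x (pcompose (pCons a Q) [:0, b:]) =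
        fps_of_poly a + fps_of_poly b * x * hom_eval fps_of_poly x (pcompose Q [:0, b:])"
      by (simp only: pcompose_pCons ex.hom_add ex.hom_mult t fps_of_poly.hom_eval_const)
    also have "\<dots> = hom_eval fps_of_poly (fps_of_poly b * x) (pCons a Q)"
      unfolding pCons by (simp add: hom_eval_def map_poly_pCons pCons.hyps)
    finally show ?case .
  qed (simp add: hom_eval_def)
  moreover have "degree (pcompose Q [:0, b:]) = degree Q" using assms by (simp add: degree_pcompose)
  moreover have "pcompose Q [:0, b:] \<noteq> 0"
    using assms pcompose_eq_0[of Q "[:0, b:]"] by auto
  ultimately show ?thesis using assms(1) by (auto simp: annihilates_def)
qed

section \<open>Powers of z and roots of unity\<close>

lemma fps_compose_X_power_X_power:
  fixes x :: "complex fps"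
  assumes "m > 0" "n > 0"
  shows "x oo fps_X ^ m oo fps_X ^ n = x oo fps_X ^ (m * n)"
proof -
  have "x oo fps_X ^ m oo fps_X ^ n = x oo (fps_X ^ m oo fps_X ^ n)"
    using assms by (intro fps_compose_assoc[symmetric]) auto
  also have "fps_X ^ m oo fps_X ^ n = (fps_X ^ (m * n) :: complex fps)"
    using assms by (simp add: power_mult mult.commute[of m] flip: fps_compose_power)
  finally show ?thesis .
qed

lemma fps_compose_scale_nth:
  "(x oo fps_of_poly [:0, \<omega>::complex:]) $ n = \<omega> ^ n * x $ n"
proof -
  have v: "fps_of_poly [:0, \<omega>:] = fps_const \<omega> * fps_X"
    by (simp add: fps_of_poly_pCons fps_of_poly_const)
  show ?thesis unfolding v fps_compose_linear by simp
qed

text \<open>The summands are the powers of q = \<omega> ^ (n - r), a K-th root of unity, so the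
  geometric sum vanishes unless q = 1. Averaging over rotations thus filters a residue class of
  exponents.\<close>

lemma sum_roots_of_unity:
  fixes K n r :: nat
  assumes "K > 0"
  defines "\<omega> \<equiv> cis (2 * pi / K)"
  shows "(\<Sum>j<K. inverse (\<omega> ^ (j * r)) * (\<omega> ^ j) ^ n) =
    (if n mod K = r mod K then of_nat K else 0)"
proof -
  define q where "q = inverse (\<omega> ^ r) * \<omega> ^ n"
  have w: "\<omega> ^ m = cis (2 * pi * m / K)" for m
    by (simp add: \<omega>_def DeMoivre mult_ac)
  have wK: "\<omega> ^ K = 1" unfolding w using assms(1) by simp
  have wm: "\<omega> ^ m = \<omega> ^ (m mod K)" for m
    by (subst mult_div_mod_eq[of K m, symmetric]) (simp only: power_add power_mult wK, simp)
  have inj: "\<omega> ^ i = \<omega> ^ j \<longleftrightarrow> i = j" if "i < K" "j < K" for i j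
    using bij_betw_roots_unity[OF assms(1)] that
    by (auto simp: w bij_betw_def inj_on_def)
  have eq: "inverse (\<omega> ^ (j * r)) * (\<omega> ^ j) ^ n = q ^ j" for j
    by (simp add: q_def power_mult_distrib power_inverse mult.commute[of j] flip: power_mult)
  have "q = 1 \<longleftrightarrow> \<omega> ^ n = \<omega> ^ r" by (simp add: q_def \<omega>_def field_simps)
  also have "\<dots> \<longleftrightarrow> n mod K = r mod K"
    using inj[of "n mod K" "r mod K"] assms(1) by (simp flip: wm)
  finally have q1: "q = 1 \<longleftrightarrow> n mod K = r mod K" .
  have qK: "q ^ K = 1"
    by (simp add: q_def power_mult_distrib power_inverse flip: power_mult)
      (simp add: mult.commute[of _ K] power_mult wK)
  show ?thesis
  proof (cases "q = 1")
    case True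
    then show ?thesis using q1 by (simp add: eq)
  next
    case False
    then show ?thesis using q1 geometric_sum[OF False, of K] qK by (simp add: eq)
  qed
qed

lemma fps_of_poly_finite_support:
  fixes f :: "complex fps"
  assumes "\<And>n. n > N \<Longrightarrow> f $ n = 0"
  shows "\<exists>p. f = fps_of_poly p"
  by (rule exI[of _ "\<Sum>i\<le>N. monom (f $ i) i"], rule fps_ext)
    (use assms in \<open>auto simp: coeff_sum not_le\<close>)

text \<open>Each end coefficient serves one direction: \<open>a e \<noteq> 0\<close> rewrites high
  \<open>g i\<close> through low ones, so all lie in V; \<open>a 0 \<noteq> 0\<close> rewrites F
  through arbitrarily high ones.\<close>

lemma lead_coeff_mult_algebraic_mahler:
  fixes a :: "nat \<Rightarrow> complex poly" and F :: "complex fps"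
  assumes k: "k \<ge> 2" and P: "annihilates P F" "P \<noteq> 0"
    and eq: "(\<Sum>i\<le>e. fps_of_poly (a i) * (F oo fps_X ^ (k ^ i))) = 0"
    and a0: "a 0 \<noteq> 0" and ae: "a e \<noteq> 0"
  shows "\<exists>p. fps_of_poly (lead_coeff P) * F = fps_of_poly p"
proof -
  define g where "g i = F oo fps_X ^ (k ^ i)" for i
  define V where "V = rational_span (g ` {..<e})"
  define h where "h = degree (grade 0 P)"
  define f where "f = fps_of_poly (lead_coeff P) * F"
  have g0: "g 0 = F" by (simp add: g_def)
  have shifted: "(\<Sum>i\<le>e. fps_of_poly (pcompose (a i) (monom 1 (k ^ s))) * g (i + s)) = 0" for s
  proof -
    have ks: "k ^ s > 0" using k by simp
    have X: "fps_of_poly (monom 1 (k ^ s)) = (fps_X ^ (k ^ s) :: complex fps)"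
      by (simp add: fps_of_poly_monom')
    have "0 = (\<Sum>i\<le>e. fps_of_poly (a i) * (F oo fps_X ^ (k ^ i))) oo fps_X ^ (k ^ s)"
      using eq by simp
    also have "\<dots> = (\<Sum>i\<le>e. (fps_of_poly (a i) oo fps_X ^ (k ^ s)) * (F oo fps_X ^ (k ^ i) oo fps_X ^ (k ^ s)))"
      using ks by (simp add: fps_compose_sum_distrib fps_compose_mult_distrib)
    also have "\<dots> = (\<Sum>i\<le>e. fps_of_poly (pcompose (a i) (monom 1 (k ^ s))) * g (i + s))"
      using ks k by (intro sum.cong refl)
        (simp add: fps_of_poly_pcompose X fps_compose_X_power_X_power g_def power_add)
    finally show ?thesis by simp
  qed
  have nz: "pcompose (a i) (monom 1 (k ^ s)) \<noteq> 0" if "a i \<noteq> 0" for i s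
    using that k by (simp add: pcompose_nonconst_eq_0_iff degree_monom_eq)
  have gV: "g i \<in> V" for i
  proof (induction i rule: less_induct)
    case (less i)
    show ?case
    proof (cases "i < e")
      case True
      then show ?thesis by (auto simp: V_def intro: rational_span.base)
    next
      case False
      define s where "s = i - e"
      let ?b = "\<lambda>j. pcompose (a j) (monom 1 (k ^ s))"
      have "{..e} = insert e {..<e}" by auto
      then have "fps_of_poly (?b e) * g (e + s) = - (\<Sum>j<e. fps_of_poly (?b j) * g (j + s))"
        using shifted[of s] by (simp add: eq_neg_iff_add_eq_0)
      also have "\<dots> \<in> V"
        unfolding V_def using less False
        by (intro rational_span_uminus rational_span_sum rational_span.mult)
          (auto simp: V_def s_def)
      finally show ?thesis
        using nz[OF ae, of s] False unfolding V_def s_def by (auto intro: rational_span.cancel)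
    qed
  qed
  have F_tail: "F \<in> rational_span (g ` {s..})" for s
  proof (induction s)
    case 0
    then show ?case by (auto intro: rational_span.base simp: g0[symmetric])
  next
    case (Suc s)
    have "g i \<in> rational_span (g ` {Suc s..})" if "i \<ge> s" for i
    proof (cases "i = s")
      case False
      then show ?thesis using that by (auto intro: rational_span.base)
    next
      case True
      let ?b = "\<lambda>j. pcompose (a j) (monom 1 (k ^ s))"
      have "{..e} = insert 0 {1..e}" by auto
      then have "fps_of_poly (?b 0) * g (0 + s) = - (\<Sum>j\<in>{1..e}. fps_of_poly (?b j) * g (j + s))"
        using shifted[of s] by (simp add: eq_neg_iff_add_eq_0)
      also have "\<dots> \<in> rational_span (g ` {Suc s..})"
        by (intro rational_span_uminus rational_span_sum rational_span.mult rational_span.base) auto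
      finally show ?thesis using nz[OF a0, of s] True by (auto intro: rational_span.cancel)
    qed
    then have "g ` {s..} \<subseteq> rational_span (g ` {Suc s..})" by auto
    then show ?case using Suc by (rule rational_span_subset)
  qed
  \<comment> \<open>F is a combination of the \<open>g i\<close> with \<open>i \<ge> s\<close>,
    which are series in z ^ (k ^ s) and so fixed by z -> \<omega> z; only the coefficients change,
    and the result stays in V.\<close>
  have twist: "f oo fps_of_poly [:0, \<omega>:] \<in> V" if w: "\<omega> ^ (k ^ s) = 1" for \<omega> s
  proof -
    have w0: "\<omega> \<noteq> 0" using w k by (auto simp: power_0_left)
    let ?v = "[:0, \<omega>:]"
    have "g i oo fps_of_poly ?v = g i" if "i \<ge> s" for i
    proof (rule fps_ext)
      fix n
      have "\<omega> ^ n * g i $ n = g i $ n"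
      proof (cases "k ^ i dvd n")
        case True
        then have "k ^ s dvd n" using that by (meson dvd_trans le_imp_power_dvd)
        then obtain c where "n = k ^ s * c" by (elim dvdE)
        then have "\<omega> ^ n = 1" by (simp only: power_mult w power_one)
        then show ?thesis by simp
      next
        case False
        then show ?thesis by (simp add: g_def fps_nth_compose_X_power)
      qed
      then show "(g i oo fps_of_poly ?v) $ n = g i $ n" by (simp only: fps_compose_scale_nth)
    qed
    then have "(\<lambda>x. x oo fps_of_poly ?v) ` (g ` {s..}) \<subseteq> V"
      using gV by auto
    moreover have "F oo fps_of_poly ?v \<in> rational_span ((\<lambda>x. x oo fps_of_poly ?v) ` (g ` {s..}))"
      using w0 by (intro rational_span_compose F_tail) auto
    ultimately have "F oo fps_of_poly ?v \<in> V"
      unfolding V_def by (rule rational_span_subset)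
    moreover have "f oo fps_of_poly ?v = fps_of_poly (pcompose (lead_coeff P) ?v) * (F oo fps_of_poly ?v)"
      by (simp add: f_def fps_of_poly_pcompose fps_compose_mult_distrib)
    ultimately show ?thesis by (simp add: V_def rational_span.mult)
  qed
  \<comment> \<open>The degree does not depend on x, so it serves all residue classes and moduli at
    once.\<close>
  have V_alg: "\<exists>Q. annihilates Q x \<and> Q \<noteq> 0 \<and> degree Q = degree P ^ e" if xV: "x \<in> V" for x
  proof -
    obtain b c where b: "b \<noteq> 0" and bx: "fps_of_poly b * x = (\<Sum>j<e. fps_of_poly (c j) * g j)"
      using rational_span_normal_form xV unfolding V_def by blast
    define A where "A = (\<Sum>j<e. degree (c j))"
    have "degree (c j) \<le> A" if "j < e" for j
      unfolding A_def using that by (intro member_le_sum) auto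
    then obtain Q where "annihilates Q (fps_of_poly b * x)" "Q \<noteq> 0" "degree Q = degree P ^ e"
      using annihilator_mahler_combination[OF P refl order_refl, of e c A k] k
      unfolding bx g_def by auto
    then show ?thesis using annihilates_cancel b by metis
  qed
  have "f $ r = 0" if r: "r > h * degree P ^ e" for r
  proof (rule ccontr)
    assume fr: "f $ r \<noteq> 0"
    \<comment> \<open>A power of k above r: the only n < K with n mod K = r is then r itself, so the
      part of f in this residue class starts at exponent r.\<close>
    define K where "K = k ^ r"
    have rK: "r < K" using k by (simp add: K_def less_exp order.strict_trans2[OF less_exp power_mono])
    then have K0: "K > 0" by simp
    define \<omega> where "\<omega> = cis (2 * pi / K)"
    \<comment> \<open>The average picks out of f the exponents congruent to r modulo K.\<close>
    define x where "x = (\<Sum>j<K. fps_const (inverse (\<omega> ^ (j * r)) / of_nat K) * (f oo fps_of_poly [:0, \<omega> ^ j:]))"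
    have wK: "\<omega> ^ K = 1" using K0 by (simp add: \<omega>_def DeMoivre)
    have w0: "\<omega> \<noteq> 0" by (simp add: \<omega>_def)
    have x_nth: "x $ n = (if n mod K = r then f $ n else 0)" for n
    proof -
      have "x $ n = (\<Sum>j<K. inverse (\<omega> ^ (j * r)) * (\<omega> ^ j) ^ n) * f $ n / of_nat K"
        by (simp add: x_def fps_sum_nth fps_compose_scale_nth sum_distrib_left sum_divide_distrib mult_ac)
      then show ?thesis using sum_roots_of_unity[OF K0, of r n] rK K0 by (simp add: \<omega>_def)
    qed
    have "x $ r \<noteq> 0" using fr rK by (simp add: x_nth)
    then have x0: "x \<noteq> 0" by auto
    have "x \<in> V"
      unfolding x_def V_def
    proof (intro rational_span_sum)
      fix j
      have "(\<omega> ^ j) ^ (k ^ r) = 1" using wK by (metis K_def mult.commute power_mult power_one)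
      then have "f oo fps_of_poly [:0, \<omega> ^ j:] \<in> rational_span (g ` {..<e})"
        using twist unfolding V_def by blast
      then show "fps_const (inverse (\<omega> ^ (j * r)) / of_nat K) * (f oo fps_of_poly [:0, \<omega> ^ j:]) \<in>
          rational_span (g ` {..<e})"
        using rational_span.mult[of _ _ "[:inverse (\<omega> ^ (j * r)) / of_nat K:]"] by (simp add: fps_of_poly_const)
    qed
    then obtain Q where Q: "annihilates Q x" "Q \<noteq> 0" "degree Q = degree P ^ e" using V_alg by blast
    have "integral_of_order h f"
      unfolding f_def h_def by (rule integral_of_order_lead_coeff_mult[OF P order_refl])
    then have "integral_of_order h x"
      unfolding x_def using w0 by (intro integral_of_order_sum integral_of_order_scale) auto
    then have "subdegree x \<le> h * degree P ^ e"
      using subdegree_integral_le[OF _ Q(1,2) x0] Q(3) by metis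
    moreover have "subdegree x \<ge> r"
    proof (rule subdegree_geI[OF x0])
      fix n assume "n < r"
      then show "x $ n = 0" using rK by (simp add: x_nth)
    qed
    ultimately show False using r by simp
  qed
  then show ?thesis using fps_of_poly_finite_support[of "h * degree P ^ e" f] by (auto simp: f_def)
qed

text \<open>F (z ^ K) has only exponents divisible by K, so the part of the equation with exponents
  congruent to j modulo K becomes an equation for F after dividing by z ^ j and writing z for z ^ K.
  Choosing j as the residue of an exponent occurring in q keeps the new factor nonzero.\<close>

lemma rational_of_compose_X_power:
  fixes F :: "complex fps"
  assumes q: "q \<noteq> 0" and K: "K > 0" and eq: "fps_of_poly q * (F oo fps_X ^ K) = fps_of_poly p"
  shows "\<exists>q' p'. q' \<noteq> 0 \<and> fps_of_poly q' * F = fps_of_poly p'"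
proof -
  obtain i0 where i0: "coeff q i0 \<noteq> 0" using q leading_coeff_0_iff by blast
  define j where "j = i0 mod K"
  have jK: "j < K" using K by (simp add: j_def)
  have sec: "\<exists>p'. \<forall>n. coeff p' n = coeff p (K * n + j)" for p :: "complex poly"
  proof -
    have "coeff p (K * n + j) = 0" if "n > degree p" for n
    proof -
      have "n \<le> K * n" using K by simp
      then show ?thesis using that by (intro coeff_eq_0) linarith
    qed
    then obtain p' where "Abs_fps (\<lambda>n. coeff p (K * n + j)) = fps_of_poly p'"
      using fps_of_poly_finite_support[of "degree p" "Abs_fps (\<lambda>n. coeff p (K * n + j))"] by auto
    then show ?thesis by (auto simp: fps_eq_iff)
  qed
  obtain q' where q': "coeff q' n = coeff q (K * n + j)" for n using sec by blast
  obtain p' where p': "coeff p' n = coeff p (K * n + j)" for n using sec by blast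
  have "fps_of_poly q' * F = fps_of_poly p'"
  proof (rule fps_ext)
    fix n
    let ?t = "\<lambda>l. coeff q l * (F oo fps_X ^ K) $ (K * n + j - l)"
    have "fps_of_poly p' $ n = (\<Sum>l=0..K * n + j. ?t l)"
      using arg_cong[OF eq, of "\<lambda>f. fps_nth f (K * n + j)"] by (simp add: p' fps_mult_nth)
    also have "\<dots> = (\<Sum>l\<in>(\<lambda>i. K * i + j) ` {0..n}. ?t l)"
    proof (rule sum.mono_neutral_right)
      show "(\<lambda>i. K * i + j) ` {0..n} \<subseteq> {0..K * n + j}" by auto
      show "\<forall>l\<in>{0..K * n + j} - (\<lambda>i. K * i + j) ` {0..n}. ?t l = 0"
      proof
        fix l assume l: "l \<in> {0..K * n + j} - (\<lambda>i. K * i + j) ` {0..n}"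
        have "\<not> K dvd K * n + j - l"
        proof
          assume "K dvd K * n + j - l"
          then obtain c where c: "K * n + j - l = K * c" by (elim dvdE)
          with l have lc: "l + K * c = K * n + j" by auto
          have "K * c < K * Suc n" using lc jK by simp
          then have "c \<le> n" by (simp only: nat_mult_less_cancel1[OF K] less_Suc_eq_le)
          then have "K * n = K * (n - c) + K * c" by (simp flip: distrib_left)
          then have "l = K * (n - c) + j" using lc by linarith
          then show False using l by auto
        qed
        then show "?t l = 0" by (simp add: fps_nth_compose_X_power)
      qed
    qed simp
    also have "\<dots> = (\<Sum>i=0..n. ?t (K * i + j))"
      using K by (subst sum.reindex) (auto simp: inj_on_def)
    also have "\<dots> = (\<Sum>i=0..n. coeff q' i * F $ (n - i))"
    proof (rule sum.cong)
      fix i assume "i \<in> {0..n}"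
      then have "K * n + j - (K * i + j) = K * (n - i)" by (simp add: diff_mult_distrib2)
      then show "?t (K * i + j) = coeff q' i * F $ (n - i)"
        using K by (simp add: fps_nth_compose_X_power q')
    qed simp
    finally show "(fps_of_poly q' * F) $ n = fps_of_poly p' $ n" by (simp add: fps_mult_nth)
  qed
  moreover have "coeff q' (i0 div K) \<noteq> 0" using i0 by (simp add: q' j_def)
  then have "q' \<noteq> 0" by auto
  ultimately show ?thesis by blast
qed

text \<open>Both end coefficients become nonzero on cutting the equation to the indices from s, the
  first with a nonzero coefficient, to m, the last, and passing to g = F (z ^ (k ^ s)). This g is
  algebraic too, and its rationality gives that of F.\<close>

lemma algebraic_mahler_rational:
  fixes a :: "nat \<Rightarrow> complex poly" and F :: "complex fps"
  assumes k: "k \<ge> 2" and P: "annihilates P F" "P \<noteq> 0"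
    and eq: "(\<Sum>i\<le>d. fps_of_poly (a i) * (F oo fps_X ^ (k ^ i))) = 0"
    and nz: "\<exists>i\<le>d. a i \<noteq> 0"
  shows "\<exists>q p. q \<noteq> 0 \<and> fps_of_poly q * F = fps_of_poly p"
proof -
  let ?I = "{i. i \<le> d \<and> a i \<noteq> 0}"
  define s where "s = Min ?I"
  define m where "m = Max ?I"
  have fin: "finite ?I" "?I \<noteq> {}" using nz by auto
  have s: "s \<le> d" "a s \<noteq> 0" using Min_in[OF fin] by (auto simp: s_def)
  have m: "m \<le> d" "a m \<noteq> 0" using Max_in[OF fin] by (auto simp: m_def)
  have out: "a i = 0" if "i \<le> d" "i < s \<or> i > m" for i
  proof (rule ccontr)
    assume "a i \<noteq> 0"
    then have "i \<in> ?I" using that by simp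
    then have "s \<le> i" "i \<le> m" unfolding s_def m_def by (auto intro: Min_le[OF fin(1)] Max_ge[OF fin(1)])
    then show False using that by linarith
  qed
  have sm: "s \<le> m" using out[of s] s by (meson not_le)
  define K where "K = k ^ s"
  have K: "K > 0" using k by (simp add: K_def)
  define g where "g = F oo fps_X ^ K"
  have "(\<Sum>i\<le>m - s. fps_of_poly (a (i + s)) * (g oo fps_X ^ (k ^ i))) =
      (\<Sum>i\<in>{s..m}. fps_of_poly (a i) * (F oo fps_X ^ (k ^ i)))"
  proof (rule sum.reindex_bij_witness[of _ "\<lambda>i. i - s" "\<lambda>i. i + s"])
    fix i
    have "k ^ i > 0" using k by simp
    then show "fps_of_poly (a (i + s)) * (F oo fps_X ^ (k ^ (i + s))) =
        fps_of_poly (a (i + s)) * (g oo fps_X ^ (k ^ i))"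
      using fps_compose_X_power_X_power[OF K] by (simp add: g_def K_def power_add mult.commute)
  qed (use sm in auto)
  also have "\<dots> = (\<Sum>i\<le>d. fps_of_poly (a i) * (F oo fps_X ^ (k ^ i)))"
    using m out by (intro sum.mono_neutral_left) auto
  finally have eq': "(\<Sum>i\<le>m - s. fps_of_poly (a (i + s)) * (g oo fps_X ^ (k ^ i))) = 0"
    using eq by simp
  let ?P = "subst_coeffs (monom 1 K) P"
  have dv: "degree (monom (1::complex) K) > 0" "coeff (monom (1::complex) K) 0 = 0"
    using K by (auto simp: degree_monom_eq)
  have P': "annihilates ?P g" "?P \<noteq> 0"
    using annihilates_subst_coeffs[OF P(1) dv(2)] P(2) dv(1)
    by (auto simp: g_def fps_of_poly_monom' subst_coeffs_eq_0_iff)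
  obtain p where p: "fps_of_poly (lead_coeff ?P) * g = fps_of_poly p"
    using lead_coeff_mult_algebraic_mahler[OF k P' eq'] s m sm by auto
  have "lead_coeff ?P \<noteq> 0" using P'(2) leading_coeff_0_iff by blast
  from rational_of_compose_X_power[OF this K p[unfolded g_def]] show ?thesis by blast
qed

subsection \<open>Minimal polynomials\<close>

lemma fls_of_poly_mult: "fls_of_poly (p * q) = fls_of_poly p * fls_of_poly q"
  by (simp add: fls_of_poly_def fps_of_poly_mult fls_times_fps_to_fls)

lemma fls_of_poly_eq_0_iff: "fls_of_poly p = 0 \<longleftrightarrow> p = 0"
  by (simp add: fls_of_poly_def)

lemma fps_to_fls_sum: "fps_to_fls (sum f S) = (\<Sum>i\<in>S. fps_to_fls (f i))"
  by (induction S rule: infinite_finite_induct) auto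

lemma algebraic_function_annihilator:
  assumes "algebraic_function g"
  obtains Q where "annihilates Q g" "Q \<noteq> 0"
proof -
  obtain p where p: "p \<noteq> 0" "\<And>i. coeff p i \<in> rational_functions" "poly p (fps_to_fls g) = 0"
    using assms by (auto simp: algebraic_function_def)
  have "\<exists>u v. coeff p i = fls_of_poly u / fls_of_poly v \<and> v \<noteq> 0" for i
    using p(2)[of i] by (auto simp: rational_functions_def)
  then obtain u v where uv: "\<And>i. coeff p i = fls_of_poly (u i) / fls_of_poly (v i)" "\<And>i. v i \<noteq> 0"
    by metis
  let ?n = "degree p"
  \<comment> \<open>Clearing denominators: \<open>w i\<close> is the polynomial that D times the
    i-th coefficient of p becomes, for D the product of all denominators.\<close>
  define w where "w i = u i * (\<Prod>j\<in>{..?n} - {i}. v j)" for i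
  define D where "D = (\<Prod>j\<le>?n. v j)"
  define Q where "Q = (\<Sum>i\<le>?n. monom (w i) i)"
  have w: "fls_of_poly (w i) = fls_of_poly D * coeff p i" if "i \<le> ?n" for i
  proof -
    have "D = v i * (\<Prod>j\<in>{..?n} - {i}. v j)"
      unfolding D_def using that by (intro prod.remove) auto
    then show ?thesis using uv by (simp add: w_def fls_of_poly_mult fls_of_poly_eq_0_iff)
  qed
  have cQ: "coeff Q i = (if i \<le> ?n then w i else 0)" for i
    by (simp add: Q_def coeff_sum)
  have "coeff Q ?n \<noteq> 0"
  proof -
    have "fls_of_poly (w ?n) \<noteq> 0"
      using w[of ?n] p(1) uv(2) by (simp add: fls_of_poly_eq_0_iff D_def)
    then show ?thesis by (simp add: cQ fls_of_poly_eq_0_iff)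
  qed
  then have "Q \<noteq> 0" by auto
  moreover have "annihilates Q g"
  proof -
    have "degree Q \<le> ?n" by (rule degree_le) (simp add: cQ)
    then have "fps_to_fls (hom_eval fps_of_poly g Q) =
        (\<Sum>i\<le>?n. fls_of_poly (coeff Q i) * fps_to_fls g ^ i)"
      by (simp add: fps_of_poly.hom_eval_altdef fps_to_fls_sum fls_times_fps_to_fls fps_to_fls_power
          fls_of_poly_def)
    also have "\<dots> = (\<Sum>i\<le>?n. fls_of_poly D * (coeff p i * fps_to_fls g ^ i))"
      by (rule sum.cong) (auto simp: cQ w)
    also have "\<dots> = fls_of_poly D * poly p (fps_to_fls g)"
      by (simp add: poly_altdef sum_distrib_left)
    finally show ?thesis using p(3) by (simp add: annihilates_def)
  qed
  ultimately show ?thesis using that by blast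
qed

text \<open>C[z][y] is factorial and C[[z]] has no zero divisors, so some prime factor of Q vanishes
  at g.\<close>

lemma annihilates_irreducible_factor:
  assumes "annihilates Q g" "Q \<noteq> 0"
  obtains P where "annihilates P g" "irreducible P"
proof -
  interpret e: comm_ring_hom "hom_eval fps_of_poly g"
    by (rule fps_of_poly.comm_ring_hom_hom_eval)
  let ?M = "prime_factorization Q"
  have "hom_eval fps_of_poly g (prod_mset ?M) = 0"
  proof -
    have "Q dvd normalize (prod_mset ?M)"
      using prod_mset_prime_factorization_weak[OF assms(2)] by simp
    then obtain c where "prod_mset ?M = Q * c" by (auto elim: dvdE)
    then show ?thesis using assms(1) by (simp add: e.hom_mult annihilates_def)
  qed
  moreover have "hom_eval fps_of_poly g (prod_mset M) = 0 \<longrightarrow> (\<exists>P\<in>#M. annihilates P g)" for M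
    by (induction M) (auto simp: annihilates_def e.hom_mult)
  ultimately obtain P where "P \<in># ?M" "annihilates P g" by blast
  then show ?thesis using that[of P] by (auto dest: in_prime_factors_imp_prime intro: prime_elem_imp_irreducible)
qed

text \<open>An irreducible annihilator exists, so the choice in \<open>minimal_poly\<close> meets
  its specification.\<close>

lemma annihilates_minimal_poly:
  assumes "algebraic_function g"
  shows "annihilates (minimal_poly g) g" and "minimal_poly g \<noteq> 0"
proof -
  obtain P where "annihilates P g" "irreducible P"
    using algebraic_function_annihilator[OF assms] annihilates_irreducible_factor by metis
  then have "is_minimal_poly g P"
    by (simp add: is_minimal_poly_def annihilates_def hom_eval_def)
  then have "is_minimal_poly g (minimal_poly g)"
    unfolding minimal_poly_def by (rule someI)
  then show "annihilates (minimal_poly g) g" "minimal_poly g \<noteq> 0"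
    by (auto simp: is_minimal_poly_def annihilates_def hom_eval_def)
qed

lemma degree_grade_0_le_deg_z: "degree (grade 0 P) \<le> deg_z P"
  unfolding degree_grade_0
proof
  fix i
  show "degree (coeff P i) \<le> deg_z P"
  proof (cases "i \<le> degree P")
    case True
    then show ?thesis unfolding deg_z_def by (intro Max_ge) auto
  qed (simp add: coeff_eq_0)
qed

section \<open>Conclusion in terms of C((z))\<close>

lemma algebraic_mahler_in_rational_functions:
  assumes "k \<ge> 2" "mahler_equation k d a F" "algebraic_function F"
  shows "fps_to_fls F \<in> rational_functions"
proof -
  have "\<exists>q p. q \<noteq> 0 \<and> fps_of_poly q * F = fps_of_poly p"
    using algebraic_mahler_rational[OF assms(1) annihilates_minimal_poly[OF assms(3)], where d = d and a = a] assms(2)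
    by (simp add: mahler_equation_def)
  then obtain q p where qp: "q \<noteq> 0" "fps_of_poly q * F = fps_of_poly p" by blast
  have "fls_of_poly q * fps_to_fls F = fls_of_poly p"
    using arg_cong[OF qp(2), of fps_to_fls] by (simp add: fls_of_poly_def fls_times_fps_to_fls)
  then have "fps_to_fls F = fls_of_poly p / fls_of_poly q"
    using qp(1) by (simp add: fls_of_poly_eq_0_iff field_simps)
  then show ?thesis using qp(1) by (auto simp: rational_functions_def)
qed

theorem theorem1:
  fixes k n :: nat and F G :: "complex fps" and a :: "nat \<Rightarrow> complex poly"
    and d_F A_F :: nat and H_G :: real
  assumes "k \<ge> 2"
    and "mahler_function k F"
    and "d_F = mahler_degree k F"
    and "mahler_equation k d_F a F"
    and "A_F = mahler_height d_F a"
    and "fps_to_fls F \<notin> rational_functions"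
    and "algebraic_function G"
    and "algebraic_degree G \<le> n"
    and "algebraic_height G \<le> H_G"
  shows "valuation (fps_to_fls F - fps_to_fls G) \<le>
    ereal ((real d_F + 1) * real A_F * real n ^ (d_F + 1)
      + (real k ^ (d_F + 1) - 1) / (real k - 1) * ln H_G * real n ^ d_F)"
proof -
  let ?P = "minimal_poly G"
  define h where "h = deg_z ?P"
  \<comment> \<open>Otherwise F would be algebraic and hence rational. This makes the valuation
    finite.\<close>
  have FG: "F \<noteq> G"
    using algebraic_mahler_in_rational_functions[OF assms(1,4)] assms(6,7) by blast
  have deg_a: "degree (a i) \<le> A_F" if "i \<le> d_F" for i
    unfolding assms(5) mahler_height_def using that by (intro Max_ge) auto
  have dP: "degree ?P \<le> n" using assms(8) by (simp add: algebraic_degree_def)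
  have h: "real h \<le> ln H_G"
    using ln_mono[of "exp (real h)" H_G] assms(9) by (simp add: algebraic_height_def h_def)
  have geom: "real (\<Sum>i\<le>d_F. k ^ i) = (real k ^ (d_F + 1) - 1) / (real k - 1)"
    using geometric_sum[of "real k" "Suc d_F"] assms(1) by (simp add: lessThan_Suc_atMost)
  \<comment> \<open>The estimate is first obtained with the true degree of the minimal polynomial;
    it grows with that degree, so n may replace it.\<close>
  have "subdegree (F - G) \<le> (d_F + 1) * A_F * degree ?P ^ (d_F + 1) + (\<Sum>i\<le>d_F. k ^ i) * h * degree ?P ^ d_F"
  proof (rule subdegree_diff_le)
    show "annihilates ?P G" "?P \<noteq> 0" by (rule annihilates_minimal_poly[OF assms(7)])+
    show "degree (grade 0 ?P) \<le> h" unfolding h_def by (rule degree_grade_0_le_deg_z)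
  qed (use assms(1,4) deg_a FG in \<open>auto simp: mahler_equation_def\<close>)
  also have "\<dots> \<le> (d_F + 1) * A_F * n ^ (d_F + 1) + (\<Sum>i\<le>d_F. k ^ i) * h * n ^ d_F"
    using dP by (intro add_mono mult_left_mono power_mono) auto
  finally have "real (subdegree (F - G)) \<le>
      real ((d_F + 1) * A_F * n ^ (d_F + 1) + (\<Sum>i\<le>d_F. k ^ i) * h * n ^ d_F)"
    by (rule of_nat_mono)
  also have "\<dots> = (real d_F + 1) * real A_F * real n ^ (d_F + 1) +
      real (\<Sum>i\<le>d_F. k ^ i) * real h * real n ^ d_F"
    by (simp only: of_nat_add of_nat_mult of_nat_power of_nat_1)
  also have "\<dots> \<le> (real d_F + 1) * real A_F * real n ^ (d_F + 1) +
      real (\<Sum>i\<le>d_F. k ^ i) * ln H_G * real n ^ d_F"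
    using h by (intro add_left_mono mult_right_mono mult_left_mono of_nat_0_le_iff zero_le_power)
  finally have bound: "real (subdegree (F - G)) \<le> (real d_F + 1) * real A_F * real n ^ (d_F + 1)
      + (real k ^ (d_F + 1) - 1) / (real k - 1) * ln H_G * real n ^ d_F"
    unfolding geom .
  have diff: "fps_to_fls F - fps_to_fls G = fps_to_fls (F - G)" by simp
  have nz: "fps_to_fls (F - G) \<noteq> 0" using FG by simp
  show ?thesis
    unfolding diff valuation_def if_not_P[OF nz] fls_subdegree_fls_to_fps of_int_of_nat_eq ereal_less_eq
    by (rule bound)
qed

end
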